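(* Let $g\ge1$. There is a constant $c=c(g)>0$ such that for every curve $C\subset\mathbb{H}_g$ (irreducible algebraic subvariety of dimension $1$) of degree $k$ we have $$\int_{C\cap S_g} dC\le c\,k.$$
   Context: $\mathbb{H}_g=\{Z=X+iY\in M_g(\mathbb{C}): Z=Z^t,\ Y>0\}$, viewed as an open subset of $M_g(\mathbb{C})^{\rm sym}\cong\mathbb{C}^{g(g+1)/2}$. An irreducible algebraic subvariety of $\mathbb{H}_g$ is an irreducible component (as complex analytic variety) of $\mathbb{H}_g\cap Y'$ with $Y'\subset\mathbb{C}^{g(g+1)/2}$ algebraic; the degree of a curve $C\subset\mathbb{H}_g$ is the degree of its Zariski closure in $\mathbb{C}^{g(g+1)/2}$. $\mathbb{H}_g$ carries the $\mathrm{Sp}_{2g}(\mathbb{R})$-invariant metric $d\mu(Z)=\mathrm{Tr}(Y^{-1}dZ\,Y^{-1}d\bar Z)$; $dC$ is the volume form on $C$ induced by its restriction. $S_g$ is the standard Siegel fundamental domain for $\mathrm{Sp}_{2g}(\mathbb{Z})$ acting on $\mathbb{H}_g$ by $\begin{pmatrix}A&B\\C&D\end{pmatrix}Z=(AZ+B)(CZ+D)^{-1}$: the set of $Z=X+iY\in\mathbb{H}_g$ with all entries of $X$ of absolute value $\le 1/2$, $Y$ Minkowski reduced, and $|\det(CZ+D)|\ge1$ for all $\begin{pmatrix}A&B\\C&D\end{pmatrix}\in\mathrm{Sp}_{2g}(\mathbb{Z})$. *)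

theory Defs
  imports "HOL-Analysis.Analysis" "HOL-Library.Uprod"
begin

section \<open>Algebraic subsets of affine space and the degree of a curve\<close>

inductive polynomial_fun :: "(complex ^ 'n \<Rightarrow> complex) \<Rightarrow> bool" where
  const: "polynomial_fun (\<lambda>_. c)"
| coord: "polynomial_fun (\<lambda>z. z $ i)"
| add: "polynomial_fun f \<Longrightarrow> polynomial_fun h \<Longrightarrow> polynomial_fun (\<lambda>z. f z + h z)"
| mult: "polynomial_fun f \<Longrightarrow> polynomial_fun h \<Longrightarrow> polynomial_fun (\<lambda>z. f z * h z)"

definition algebraic_set :: "(complex ^ 'n) set \<Rightarrow> bool" where
  "algebraic_set V \<longleftrightarrow>
     (\<exists>F. finite F \<and> (\<forall>f\<in>F. polynomial_fun f) \<and> V = {z. \<forall>f\<in>F. f z = 0})"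

definition zariski_closure :: "(complex ^ 'n) set \<Rightarrow> (complex ^ 'n) set" where
  "zariski_closure S = \<Inter>{V. algebraic_set V \<and> S \<subseteq> V}"

definition affine_hyperplane :: "complex ^ ('n option) \<Rightarrow> (complex ^ 'n) set" where
  "affine_hyperplane a = {z. a $ None + (\<Sum>i\<in>UNIV. a $ Some i * z $ i) = 0}"

text \<open>
  The degree of an affine algebraic curve \<open>V\<close> is the number of points in which a general
  hyperplane meets \<open>V\<close>; ``general'' means: with coefficient vector outside some proper
  Zariski closed subset, which is contained in the zero set of one nonzero polynomial \<open>p\<close>.
  Since a general hyperplane of projective space avoids the finitely many points of \<open>V\<close> at
  infinity, this is also the degree of the projective closure.
\<close>

definition curve_has_degree :: "(complex ^ 'n) set \<Rightarrow> nat \<Rightarrow> bool" where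
  "curve_has_degree V k \<longleftrightarrow>
     (\<exists>p :: complex ^ ('n option) \<Rightarrow> complex.
        polynomial_fun p \<and> (\<exists>a. p a \<noteq> 0) \<and>
        (\<forall>a. p a \<noteq> 0 \<longrightarrow>
           finite (V \<inter> affine_hyperplane a) \<and> card (V \<inter> affine_hyperplane a) = k))"


section \<open>Analytic subsets of an open set\<close>

text \<open>Holomorphy in several variables: the total derivative exists and is complex linear.\<close>

definition mholomorphic_on :: "(complex ^ 'n \<Rightarrow> complex) \<Rightarrow> (complex ^ 'n) set \<Rightarrow> bool" where
  "mholomorphic_on f W \<longleftrightarrow>
     (\<forall>z\<in>W. \<exists>a :: complex ^ 'n. (f has_derivative (\<lambda>h. \<Sum>i\<in>UNIV. a $ i * h $ i)) (at z))"

definition analytic_subset :: "(complex ^ 'n) set \<Rightarrow> (complex ^ 'n) set \<Rightarrow> bool" where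
  "analytic_subset U A \<longleftrightarrow> A \<subseteq> U \<and>
     (\<forall>p\<in>U. \<exists>W F. open W \<and> p \<in> W \<and> W \<subseteq> U \<and> finite F \<and> (\<forall>f\<in>F. mholomorphic_on f W) \<and>
        A \<inter> W = {z \<in> W. \<forall>f\<in>F. f z = 0})"

definition irreducible_analytic :: "(complex ^ 'n) set \<Rightarrow> (complex ^ 'n) set \<Rightarrow> bool" where
  "irreducible_analytic U A \<longleftrightarrow> analytic_subset U A \<and> A \<noteq> {} \<and>
     (\<forall>A1 A2. analytic_subset U A1 \<and> analytic_subset U A2 \<and> A = A1 \<union> A2 \<longrightarrow> A = A1 \<or> A = A2)"

definition irreducible_component ::
  "(complex ^ 'n) set \<Rightarrow> (complex ^ 'n) set \<Rightarrow> (complex ^ 'n) set \<Rightarrow> bool" where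
  "irreducible_component U X A \<longleftrightarrow> irreducible_analytic U A \<and> A \<subseteq> X \<and>
     (\<forall>B. irreducible_analytic U B \<and> A \<subseteq> B \<and> B \<subseteq> X \<longrightarrow> B = A)"

definition biholomorphic ::
  "(complex ^ 'n \<Rightarrow> complex ^ 'n) \<Rightarrow> (complex ^ 'n) set \<Rightarrow> (complex ^ 'n) set \<Rightarrow> bool" where
  "biholomorphic \<phi> W W' \<longleftrightarrow> open W \<and> open W' \<and>
     (\<exists>\<psi>. homeomorphism W W' \<phi> \<psi> \<and>
        (\<forall>i. mholomorphic_on (\<lambda>z. \<phi> z $ i) W) \<and> (\<forall>i. mholomorphic_on (\<lambda>w. \<psi> w $ i) W'))"

text \<open>Near \<open>p\<close> the set \<open>A\<close> is a \<open>d\<close>-dimensional complex submanifold.\<close>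

definition regular_point :: "nat \<Rightarrow> (complex ^ 'n) set \<Rightarrow> complex ^ 'n \<Rightarrow> bool" where
  "regular_point d A p \<longleftrightarrow> p \<in> A \<and>
     (\<exists>\<phi> W W' I. p \<in> W \<and> biholomorphic \<phi> W W' \<and> card I = d \<and>
        \<phi> ` (A \<inter> W) = {w \<in> W'. \<forall>i. i \<notin> I \<longrightarrow> w $ i = 0})"

text \<open>The dimension of an analytic set is its largest dimension at a regular point.\<close>

definition has_analytic_dim :: "(complex ^ 'n) set \<Rightarrow> nat \<Rightarrow> bool" where
  "has_analytic_dim A d \<longleftrightarrow>
     (\<exists>p. regular_point d A p) \<and> (\<forall>p e. regular_point e A p \<longrightarrow> e \<le> d)"


section \<open>The volume of a one-dimensional analytic set\<close>

text \<open>
  A Riemannian metric is a family \<open>G z\<close> of real inner products on the tangent spaces; the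
  volume form it induces on the surface \<open>\<gamma> (x + i y)\<close> is
  \<open>sqrt (G(u, u) G(v, v) - G(u, v)^2) dx dy\<close> with \<open>u = \<partial>\<gamma>/\<partial>x\<close> and \<open>v = \<partial>\<gamma>/\<partial>y\<close>.
  For holomorphic \<open>\<gamma>\<close> one has \<open>u = \<gamma>'\<close> and \<open>v = \<i> \<gamma>'\<close>.
\<close>

definition chart_deriv :: "(complex \<Rightarrow> complex ^ 'n) \<Rightarrow> complex \<Rightarrow> complex ^ 'n" where
  "chart_deriv \<gamma> t = (\<chi> i. deriv (\<lambda>s. \<gamma> s $ i) t)"

definition area_density ::
  "(complex ^ 'n \<Rightarrow> complex ^ 'n \<Rightarrow> complex ^ 'n \<Rightarrow> real) \<Rightarrow>
   (complex \<Rightarrow> complex ^ 'n) \<Rightarrow> complex \<Rightarrow> real" where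
  "area_density G \<gamma> t =
     (let u = chart_deriv \<gamma> t; v = (\<chi> i. \<i> * chart_deriv \<gamma> t $ i)
      in sqrt (G (\<gamma> t) u u * G (\<gamma> t) v v - (G (\<gamma> t) u v)\<^sup>2))"

definition curve_chart ::
  "(complex ^ 'n) set \<Rightarrow> complex set \<Rightarrow> (complex \<Rightarrow> complex ^ 'n) \<Rightarrow> bool" where
  "curve_chart C D \<gamma> \<longleftrightarrow> open D \<and> (\<forall>i. (\<lambda>t. \<gamma> t $ i) holomorphic_on D) \<and>
     (\<forall>t\<in>D. chart_deriv \<gamma> t \<noteq> 0) \<and> (\<exists>\<delta>. homeomorphism D (\<gamma> ` D) \<gamma> \<delta>) \<and>
     openin (top_of_set C) (\<gamma> ` D)"

text \<open>
  The volume of a Borel subset \<open>E\<close> of \<open>C\<close> is the volume of the part of \<open>E\<close> in the regular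
  locus. The regular locus is a countable disjoint union of Borel sets, each lying in the image
  of one chart, so the volume is the supremum, over all finite families of pairwise disjoint
  Borel pieces \<open>\<gamma> ` B\<close> lying in charts, of the total volume of \<open>E\<close> in these pieces.
\<close>

definition disjoint_chart_pieces ::
  "(complex ^ 'n) set \<Rightarrow> ((complex \<Rightarrow> complex ^ 'n) \<times> complex set) set \<Rightarrow> bool" where
  "disjoint_chart_pieces C P \<longleftrightarrow> finite P \<and>
     (\<forall>(\<gamma>, B)\<in>P. B \<in> sets borel \<and> (\<exists>D. curve_chart C D \<gamma> \<and> B \<subseteq> D)) \<and>
     disjoint_family_on (\<lambda>(\<gamma>, B). \<gamma> ` B) P"

definition curve_volume ::
  "(complex ^ 'n \<Rightarrow> complex ^ 'n \<Rightarrow> complex ^ 'n \<Rightarrow> real) \<Rightarrow>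
   (complex ^ 'n) set \<Rightarrow> (complex ^ 'n) set \<Rightarrow> ennreal" where
  "curve_volume G C E =
     (SUP P \<in> Collect (disjoint_chart_pieces C).
        \<Sum>(\<gamma>, B)\<in>P. \<integral>\<^sup>+t\<in>{t \<in> B. \<gamma> t \<in> E}. ennreal (area_density G \<gamma> t) \<partial>lborel)"


section \<open>The Siegel upper half space\<close>

text \<open>
  The index type \<^typ>\<open>'g uprod\<close> of unordered pairs has \<open>g (g + 1) / 2\<close> elements
  (\<open>card_UNIV_uprod\<close>), so \<open>complex ^ 'g uprod\<close> is the space of symmetric matrices in terms
  of the independent entries.
\<close>

instance uprod :: (finite) finite
  by standard simp

definition sym_mat :: "'a ^ ('g::finite uprod) \<Rightarrow> 'a ^ 'g ^ 'g" where
  "sym_mat z = (\<chi> i j. z $ Upair i j)"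

lemma bij_betw_sym_mat:
  "bij_betw (sym_mat :: 'a ^ ('g::finite uprod) \<Rightarrow> _) UNIV {Z. transpose Z = Z}"
proof (rule bij_betw_imageI)
  show "inj (sym_mat :: 'a ^ ('g uprod) \<Rightarrow> _)"
  proof (rule injI)
    fix z w :: "'a ^ ('g uprod)"
    assume "sym_mat z = sym_mat w"
    then have "z $ Upair i j = w $ Upair i j" for i j
      by (simp add: sym_mat_def vec_eq_iff)
    then have "z $ p = w $ p" for p
      by (cases p) simp
    then show "z = w"
      by (simp add: vec_eq_iff)
  qed
  have "Z \<in> range (sym_mat :: 'a ^ ('g uprod) \<Rightarrow> _)"
    if Z: "transpose Z = Z" for Z :: "'a ^ 'g ^ 'g"
  proof -
    have s: "Z $ i $ j = Z $ j $ i" for i j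
      using Z by (metis transpose_def vec_lambda_beta)
    define z :: "'a ^ ('g uprod)"
      where "z = (\<chi> p. SOME x. \<exists>i j. p = Upair i j \<and> x = Z $ i $ j)"
    have "z $ Upair i j = Z $ i $ j" for i j
      unfolding z_def vec_lambda_beta by (rule some_equality) (auto simp: s)
    then have "Z = sym_mat z"
      by (simp add: sym_mat_def vec_eq_iff)
    then show ?thesis by (rule range_eqI)
  qed
  moreover have "transpose (sym_mat z) = sym_mat z" for z :: "'a ^ ('g uprod)"
  proof -
    have "z $ Upair i j = z $ Upair j i" for i j
      by (rule arg_cong[where f = "($) z"]) simp
    then show ?thesis
      unfolding sym_mat_def transpose_def by (simp add: vec_eq_iff)
  qed
  ultimately show "range (sym_mat :: 'a ^ ('g uprod) \<Rightarrow> _) = {Z. transpose Z = Z}"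
    by blast
qed

definition re_mat :: "complex ^ ('g::finite uprod) \<Rightarrow> real ^ 'g ^ 'g" where
  "re_mat z = (\<chi> i j. Re (sym_mat z $ i $ j))"

definition im_mat :: "complex ^ ('g::finite uprod) \<Rightarrow> real ^ 'g ^ 'g" where
  "im_mat z = (\<chi> i j. Im (sym_mat z $ i $ j))"

definition siegel_space :: "(complex ^ ('g::finite uprod)) set" where
  "siegel_space = {z. \<forall>x. x \<noteq> 0 \<longrightarrow> x \<bullet> (im_mat z *v x) > 0}"

text \<open>
  The Riemannian metric \<open>Tr (Y^-1 dZ Y^-1 dZbar)\<close>, as the real part of the associated
  Hermitian form.
\<close>

definition siegel_metric ::
  "complex ^ ('g::finite uprod) \<Rightarrow> complex ^ ('g::finite uprod) \<Rightarrow> complex ^ ('g::finite uprod) \<Rightarrow> real" where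
  "siegel_metric z u v =
     (let R = (map_matrix of_real (matrix_inv (im_mat z)) :: complex ^ 'g ^ 'g)
      in Re (trace (R ** sym_mat u ** R ** map_matrix cnj (sym_mat v))))"

definition symplectic_form :: "int ^ ('g::finite + 'g) ^ ('g + 'g)" where
  "symplectic_form = (\<chi> i j. case (i, j) of
       (Inl a, Inr b) \<Rightarrow> if a = b then 1 else 0
     | (Inr a, Inl b) \<Rightarrow> if a = b then - 1 else 0
     | _ \<Rightarrow> 0)"

definition Sp_int :: "(int ^ ('g::finite + 'g) ^ ('g + 'g)) set" where
  "Sp_int = {M. transpose M ** symplectic_form ** M = symplectic_form}"

text \<open>The matrix \<open>C Z + D\<close>, where \<open>(C D)\<close> is the lower half of \<open>M\<close>.\<close>

definition cocycle :: "int ^ ('g::finite + 'g) ^ ('g + 'g) \<Rightarrow> complex ^ ('g::finite uprod) \<Rightarrow> complex ^ 'g ^ 'g" where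
  "cocycle M z =
     (let C = \<chi> i j. of_int (M $ Inr i $ Inl j); D = \<chi> i j. of_int (M $ Inr i $ Inr j)
      in C ** sym_mat z + D)"

text \<open>
  Minkowski reduction for a positive definite symmetric matrix \<open>Y\<close>: the order on \<open>'g\<close> is the
  order of the indices \<open>1, ..., g\<close>, and the last condition concerns the entries next to the
  diagonal.
\<close>

definition minkowski_reduced :: "real ^ ('g::{finite, linorder}) ^ ('g::{finite, linorder}) \<Rightarrow> bool" where
  "minkowski_reduced Y \<longleftrightarrow>
     (\<forall>k. \<forall>a :: int ^ ('g::{finite, linorder}). (GCD i\<in>{k..}. a $ i) = 1 \<longrightarrow>
        Y $ k $ k \<le> (let x = \<chi> i. of_int (a $ i) in x \<bullet> (Y *v x))) \<and>
     (\<forall>k l. k < l \<and> \<not> (\<exists>m. k < m \<and> m < l) \<longrightarrow> 0 \<le> Y $ k $ l)"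

definition siegel_fundamental_domain :: "(complex ^ ('g::{finite, linorder} uprod)) set" where
  "siegel_fundamental_domain = {z \<in> siegel_space.
     (\<forall>i j. \<bar>re_mat z $ i $ j\<bar> \<le> 1 / 2) \<and> minkowski_reduced (im_mat z) \<and>
     (\<forall>M\<in>Sp_int. cmod (det (cocycle M z)) \<ge> 1)}"

definition siegel_curve :: "(complex ^ ('g::finite uprod)) set \<Rightarrow> bool" where
  "siegel_curve C \<longleftrightarrow>
     (\<exists>V. algebraic_set V \<and> irreducible_component siegel_space (siegel_space \<inter> V) C) \<and>
     has_analytic_dim C 1"

end

theory Submission
  imports Defs "HOL-Complex_Analysis.Conformal_Mappings"
begin

text \<open>
  On the fundamental domain, reduction theory shows that the entries of \<open>Y^-1\<close> are at most a constant
  times \<open>(y_i y_j)^(-1/2)\<close> in terms of the diagonal entries \<open>y_i\<close> of \<open>Y\<close>, so the metric is dominated by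
  the sum of the \<open>|dz_ij|^2 / (y_i y_j)\<close>. Moreover \<open>y_i y_j \<ge> max (3/4) (Im z_ij)^2\<close>. The volume is therefore
  bounded by the sum over the coordinates \<open>z_ij\<close> of the area, counted with multiplicity, which the
  curve covers in the strip \<open>|Re w| \<le> 1/2\<close>, measured with the integrable weight
  \<open>1 / max (3/4) (Im w)^2\<close>. The multiplicity is at most the degree \<open>k\<close>: if the curve meets \<open>z_ij = w\<close>
  transversally in \<open>m\<close> points, then every nearby hyperplane, in particular a generic
  one, meets it in at least \<open>m\<close> points.
\<close>

section \<open>Change of variables in the complex plane\<close>

text \<open>The degree controls only generic hyperplanes, whereas \<open>z_ij = w\<close> is a
  special one: it may be tangent to the curve or even contain it. Tangencies are harmless, since the
  area covered by a coordinate has density \<open>|dz_ij|^2\<close>, which vanishes there. The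
  volume is a supremum over finite families of chart pieces, so the count of points must be uniform
  over the whole family; disjointness of the pieces provides this. In the reduction theory,
  Minkowski's inequalities concern integral vectors only, while an entry of \<open>Y^-1\<close> is a
  matter of real vectors. Dirichlet approximation bridges the gap: it gives
  \<open>sqrt y_i * |x_i| \<le> c * sqrt (x^T Y x)\<close> for all real \<open>x\<close>, which is
  then applied to the columns of \<open>Y^-1\<close>. The value 3/4 comes from the symplectic
  matrices that invert a single coordinate and so force \<open>|z_ii| \<ge> 1\<close>.\<close>

definition cplx :: "real ^ 2 \<Rightarrow> complex" where "cplx v = Complex (v $ 1) (v $ 2)"
definition vec2 :: "complex \<Rightarrow> real ^ 2" where "vec2 z = vector [Re z, Im z]"

lemma cplx_vec2 [simp]: "cplx (vec2 z) = z"
  by (simp add: cplx_def vec2_def)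

lemma vec2_cplx [simp]: "vec2 (cplx v) = v"
  by (simp add: cplx_def vec2_def vec_eq_iff forall_2)

lemma linear_cplx: "linear cplx"
  by (rule linearI) (simp_all add: cplx_def complex_eq_iff)

lemma linear_vec2: "linear vec2"
  by (rule linearI) (simp_all add: vec2_def vec_eq_iff forall_2)

lemma has_derivative_cplx: "(cplx has_derivative cplx) F"
  using bounded_linear_imp_has_derivative linear_cplx linear_conv_bounded_linear by blast

lemma has_derivative_vec2: "(vec2 has_derivative vec2) F"
  using bounded_linear_imp_has_derivative linear_vec2 linear_conv_bounded_linear by blast

lemma borel_measurable_cplx [measurable]: "cplx \<in> borel_measurable borel"
  using borel_measurable_continuous_onI linear_continuous_on linear_conv_bounded_linear linear_cplx by blast

text \<open>The area formula with determinants lives on \<open>real ^ 2\<close>. This identity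
  carries it to the complex plane: \<open>cplx\<close> matches boxes with boxes of the same area,
  which determines the measure.\<close>

lemma lborel_distr_cplx: "distr lborel borel cplx = lborel"
proof (rule lborel_eqI[symmetric])
  fix l u :: complex
  assume le: "\<And>b. b \<in> Basis \<Longrightarrow> l \<bullet> b \<le> u \<bullet> b"
  have "cplx -` box l u = box (vec2 l) (vec2 u)"
    by (auto simp: box_def cplx_def vec2_def Basis_complex_def Basis_vec_def cart_eq_inner_axis[symmetric] exhaust_2 UNIV_2 inner_axis)
  moreover have "emeasure lborel (box (vec2 l) (vec2 u)) = ennreal ((Re u - Re l) * (Im u - Im l))"
    using le[of 1] le[of \<i>]
    by (subst emeasure_lborel_box)
      (auto simp: Basis_vec_def vec2_def UNIV_2 inner_axis Basis_complex_def axis_eq_axis)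
  ultimately show "emeasure (distr lborel borel cplx) (box l u) = (\<Prod>b\<in>Basis. (u - l) \<bullet> b)"
    by (simp add: emeasure_distr Basis_complex_def)
qed simp

lemma nn_integral_det_le_emeasure_image:
  fixes f :: "real^'n::{finite,wellorder} \<Rightarrow> real^'n::_"
  assumes S: "S \<in> sets borel"
    and der: "\<And>x. x \<in> S \<Longrightarrow> (f has_derivative f' x) (at x within S)"
    and inj: "inj_on f S"
    and fS: "f ` S \<in> sets borel"
  shows "(\<integral>\<^sup>+x\<in>S. ennreal \<bar>det (matrix (f' x))\<bar> \<partial>lborel) \<le> emeasure lborel (f ` S)"
proof (cases "emeasure lborel (f ` S) = \<infinity>")
  case False
  then have "f ` S \<in> lmeasurable"
    using fS by (auto intro!: fmeasurableI simp: top.not_eq_extremum)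
  moreover have "S \<in> sets lebesgue"
    using S by simp
  ultimately have "((\<lambda>x. \<bar>det (matrix (f' x))\<bar>) has_integral measure lebesgue (f ` S)) S"
    using has_measure_differentiable_image[OF _ der inj] by blast
  then have "(\<integral>\<^sup>+x\<in>S. ennreal \<bar>det (matrix (f' x))\<bar> \<partial>lborel) = ennreal (measure lebesgue (f ` S))"
    by (intro nn_integral_has_integral_lebesgue') auto
  then show ?thesis
    using False fS by (simp add: emeasure_eq_ennreal_measure)
qed simp

text \<open>The real matrix of multiplication by \<open>a + b\<i>\<close> has rows
  \<open>(a, -b)\<close> and \<open>(b, a)\<close>. Hence the Jacobian of a holomorphic map is the
  squared modulus of its derivative.\<close>

lemma det_matrix_complex_mult: "det (matrix (\<lambda>v. vec2 (c * cplx v))) = (cmod c)\<^sup>2"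
  by (simp add: det_2 matrix_def vec2_def cplx_def axis_def cmod_power2 flip: power2_eq_square)

lemma borel_measurable_change_of_variables:
  fixes h :: "complex \<Rightarrow> ennreal"
  assumes U: "open U" and g: "g holomorphic_on U" and A: "A \<in> sets borel" and AU: "A \<subseteq> U"
    and h[measurable]: "h \<in> borel_measurable borel"
  shows "(\<lambda>t. h (g t) * ennreal ((cmod (deriv g t))\<^sup>2) * indicator A t) \<in> borel_measurable borel"
proof -
  have "deriv g \<in> borel_measurable (restrict_space borel U)" "g \<in> borel_measurable (restrict_space borel U)"
    using g holomorphic_deriv[OF g U] holomorphic_on_imp_continuous_on borel_measurable_continuous_on_restrict by blast+
  note this[THEN measurable_restrict_mono[OF _ AU]]
  then have "(\<lambda>t. h (g t) * ennreal ((cmod (deriv g t))\<^sup>2)) \<in> borel_measurable (restrict_space borel A)"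
    by measurable
  then show ?thesis
    by (rule borel_measurable_restrict_space_iff_ennreal[THEN iffD1, rotated]) (simp add: A)
qed

lemma holomorphic_area_le:
  assumes U: "open U" and g: "g holomorphic_on U" and inj: "inj_on g U"
    and A: "A \<in> sets borel" and AU: "A \<subseteq> U"
  shows "g ` A \<in> sets borel"
    and "(\<integral>\<^sup>+t\<in>A. ennreal ((cmod (deriv g t))\<^sup>2) \<partial>lborel) \<le> emeasure lborel (g ` A)"
proof -
  obtain k where k: "k holomorphic_on g ` U" "\<And>z. z \<in> U \<Longrightarrow> k (g z) = z"
    using holomorphic_has_inverse[OF g U inj] by metis
  have ogU: "open (g ` U)"
    using g U inj open_mapping_thm3 by blast
  have eq: "g ` A = k -` A \<inter> g ` U"
    using k(2) AU by force
  show borel: "g ` A \<in> sets borel"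
    unfolding eq using borel_measurable_continuous_on_restrict[OF holomorphic_on_imp_continuous_on[OF k(1)]]
      ogU A by (auto simp: measurable_def sets_restrict_space space_restrict_space Int_commute)
  show "(\<integral>\<^sup>+t\<in>A. ennreal ((cmod (deriv g t))\<^sup>2) \<partial>lborel) \<le> emeasure lborel (g ` A)"
  proof -
    let ?S = "cplx -` A" and ?f = "vec2 \<circ> g \<circ> cplx"
    have [measurable]: "A \<in> sets borel"
      by (rule A)
    have S: "?S \<in> sets borel"
      using measurable_sets_borel[OF borel_measurable_cplx A] by simp
    have fS: "?f ` ?S = cplx -` (g ` A)"
    proof (intro set_eqI iffI)
      fix x assume "x \<in> cplx -` g ` A"
      then obtain t where "t \<in> A" "cplx x = g t" by auto
      then have "x = ?f (vec2 t)" "vec2 t \<in> ?S" using vec2_cplx[of x] by auto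
      then show "x \<in> ?f ` ?S" by blast
    qed auto
    have fSb: "?f ` ?S \<in> sets borel"
      unfolding fS using measurable_sets_borel[OF borel_measurable_cplx borel] by simp
    have der: "(?f has_derivative (\<lambda>v. vec2 (deriv g (cplx x) * cplx v))) (at x within ?S)" if "x \<in> ?S" for x
    proof -
      have "(g has_field_derivative deriv g (cplx x)) (at (cplx x))"
        using that AU g U holomorphic_derivI by blast
      then have "(g has_derivative (\<lambda>h. deriv g (cplx x) * h)) (at (cplx x))"
        by (simp add: has_field_derivative_def)
      from diff_chain_at[OF diff_chain_at[OF has_derivative_cplx this] has_derivative_vec2]
      show ?thesis
        by (simp add: o_def has_derivative_at_withinI)
    qed
    have injf: "inj_on ?f ?S"
    proof (rule inj_onI)
      fix x y assume *: "x \<in> ?S" "y \<in> ?S" "?f x = ?f y"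
      then have "cplx (?f x) = cplx (?f y)" by simp
      then have "g (cplx x) = g (cplx y)" by simp
      then have "cplx x = cplx y" using * AU by (auto intro: inj_onD[OF inj])
      then have "vec2 (cplx x) = vec2 (cplx y)" by simp
      then show "x = y" by simp
    qed
    note [measurable] = borel_measurable_change_of_variables[OF U g A AU, of "\<lambda>_. 1", simplified]
    have "(\<integral>\<^sup>+t\<in>A. ennreal ((cmod (deriv g t))\<^sup>2) \<partial>lborel)
        = (\<integral>\<^sup>+t\<in>A. ennreal ((cmod (deriv g t))\<^sup>2) \<partial>distr lborel borel cplx)"
      by (simp add: lborel_distr_cplx)
    also have "\<dots> = (\<integral>\<^sup>+x\<in>?S. ennreal ((cmod (deriv g (cplx x)))\<^sup>2) \<partial>lborel)"
      by (subst nn_integral_distr) (measurable, auto simp: indicator_def intro!: nn_integral_cong)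
    also have "\<dots> \<le> emeasure lborel (?f ` ?S)"
      using nn_integral_det_le_emeasure_image[OF S der injf fSb] by (simp add: det_matrix_complex_mult)
    also have "\<dots> = emeasure (distr lborel borel cplx) (g ` A)"
      unfolding fS using borel by (simp add: emeasure_distr)
    finally show ?thesis
      by (simp add: lborel_distr_cplx)
  qed
qed

lemma holomorphic_change_of_variables_le:
  assumes U: "open U" and g: "g holomorphic_on U" and inj: "inj_on g U"
    and A: "A \<in> sets borel" and AU: "A \<subseteq> U" and h[measurable]: "h \<in> borel_measurable borel"
  shows "(\<integral>\<^sup>+t\<in>A. h (g t) * ennreal ((cmod (deriv g t))\<^sup>2) \<partial>lborel) \<le> (\<integral>\<^sup>+w\<in>g ` A. h w \<partial>lborel)"
proof -
  let ?j = "\<lambda>t. ennreal ((cmod (deriv g t))\<^sup>2) * indicator A t"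
  \<comment> \<open>The default 0 off \<open>A\<close> makes the map Borel on the whole plane; the
    density \<open>?j\<close> vanishes there, so the value is never seen.\<close>
  let ?g = "\<lambda>t. if t \<in> A then g t else 0"
  let ?N = "distr (density lborel ?j) borel ?g" and ?M = "density lborel (indicator (g ` A))"
  have [measurable]: "A \<in> sets borel" "g ` A \<in> sets borel"
    using A holomorphic_area_le(1)[OF U g inj A AU] by auto
  have "g \<in> borel_measurable (restrict_space borel U)"
    using g holomorphic_on_imp_continuous_on borel_measurable_continuous_on_restrict by blast
  from measurable_restrict_mono[OF this AU] have "g \<in> borel_measurable (restrict_space borel A)" .
  then have gm[measurable]: "?g \<in> borel_measurable borel"
    by (subst measurable_restrict_space_iff[symmetric]) (auto simp: A)
  have jm[measurable]: "?j \<in> borel_measurable borel"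
    by (rule borel_measurable_change_of_variables[OF U g A AU, of "\<lambda>_. 1", simplified])
  have "?N \<le> ?M"
  proof (rule le_measure[THEN iffD2, rule_format], simp)
    fix B assume "B \<in> sets ?N"
    then have B[measurable]: "B \<in> sets borel" by simp
    have B': "A \<inter> ?g -` B \<in> sets borel"
      using measurable_sets_borel[OF gm B] A by auto
    have img: "g ` (A \<inter> ?g -` B) = g ` A \<inter> B" by auto
    have "emeasure ?N B = (\<integral>\<^sup>+t\<in>?g -` B. ?j t \<partial>lborel)"
      using measurable_sets_borel[OF gm B] by (simp add: emeasure_distr emeasure_density)
    also have "\<dots> = (\<integral>\<^sup>+t\<in>A \<inter> ?g -` B. ennreal ((cmod (deriv g t))\<^sup>2) \<partial>lborel)"
      by (intro nn_integral_cong) (auto simp: indicator_def)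
    also have "\<dots> \<le> emeasure lborel (g ` A \<inter> B)"
      using holomorphic_area_le(2)[OF U g inj B'] AU img by auto
    also have "\<dots> = emeasure ?M B"
      by (subst emeasure_density)
        (auto simp: nn_integral_indicator[symmetric] indicator_inter_arith simp del: nn_integral_indicator)
    finally show "emeasure ?N B \<le> emeasure ?M B" .
  qed
  have "(\<integral>\<^sup>+t\<in>A. h (g t) * ennreal ((cmod (deriv g t))\<^sup>2) \<partial>lborel) = (\<integral>\<^sup>+t. ?j t * h (?g t) \<partial>lborel)"
    by (intro nn_integral_cong) (auto simp: indicator_def mult_ac)
  also have "\<dots> = (\<integral>\<^sup>+w. h w \<partial>?N)"
    by (simp add: nn_integral_distr nn_integral_density)
  also have "\<dots> \<le> (\<integral>\<^sup>+w. h w \<partial>?M)"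
    using \<open>?N \<le> ?M\<close> by (intro nn_integral_mono_measure) auto
  also have "\<dots> = (\<integral>\<^sup>+w\<in>g ` A. h w \<partial>lborel)"
    by (simp add: nn_integral_density mult_ac)
  finally show ?thesis .
qed

section \<open>Transversal intersections with hyperplanes\<close>

text \<open>Restriction to a line reduces genericity to the finiteness of the roots of a polynomial
  in one variable.\<close>

lemma polynomial_fun_on_line:
  assumes "polynomial_fun p"
  shows "\<exists>q. \<forall>s. p (\<chi> i. a $ i + s * b $ i) = poly q s"
  using assms
proof induction
  case (const c)
  show ?case by (rule exI[of _ "[:c:]"]) simp
next
  case (coord i)
  show ?case by (rule exI[of _ "[:a $ i, b $ i:]"]) simp
next
  case (add f h)
  then obtain q r where "\<forall>s. f (\<chi> i. a $ i + s * b $ i) = poly q s" "\<forall>s. h (\<chi> i. a $ i + s * b $ i) = poly r s"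
    by blast
  then show ?case by (intro exI[of _ "q + r"]) simp
next
  case (mult f h)
  then obtain q r where "\<forall>s. f (\<chi> i. a $ i + s * b $ i) = poly q s" "\<forall>s. h (\<chi> i. a $ i + s * b $ i) = poly r s"
    by blast
  then show ?case by (intro exI[of _ "q * r"]) simp
qed

text \<open>The point \<open>a\<close> may itself be a zero. On the line from \<open>a\<close>
  through \<open>c\<close> the restriction is nonzero at parameter 1, so its roots are finite in
  number and small nonzero parameters avoid them.\<close>

lemma polynomial_fun_nonzero_near:
  assumes p: "polynomial_fun p" and c: "p c \<noteq> 0"
  obtains b where "\<forall>\<^sub>F s in at 0. p (\<chi> i. a $ i + s * b $ i) \<noteq> 0"
proof -
  define b where "b = c - a"
  obtain q where q: "\<And>s. p (\<chi> i. a $ i + s * b $ i) = poly q s"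
    using polynomial_fun_on_line[OF p] by blast
  have "(\<chi> i. a $ i + 1 * b $ i) = c"
    by (simp add: b_def vec_eq_iff)
  then have "poly q 1 \<noteq> 0"
    using q[of 1] c by simp
  then have "finite {s. poly q s = 0}"
    using poly_roots_finite[of q] by fastforce
  then have "open (- ({s. poly q s = 0} - {0}))"
    by (intro open_Compl finite_imp_closed) auto
  then have "\<forall>\<^sub>F s in at 0. poly q s \<noteq> 0"
    by (auto simp: eventually_at_topological intro!: exI[of _ "- ({s. poly q s = 0} - {0})"])
  then show thesis
    using that[of b] by (simp add: q)
qed

text \<open>A Rouche-type argument: on a small circle \<open>f\<close> stays away from 0, so after a
  small perturbation the modulus at the centre is still below that on the circle. This forces a zero
  inside.\<close>

lemma simple_zero_persists:
  assumes U: "open U" "t \<in> U" and f: "f holomorphic_on U" "f t = 0" "deriv f t \<noteq> 0" and e: "e holomorphic_on U"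
  shows "\<forall>\<^sub>F s in at 0. \<exists>t'\<in>U. f t' + s * e t' = 0"
proof -
  obtain r where r: "r > 0" "ball t r \<subseteq> U" "inj_on f (ball t r)"
    using has_complex_derivative_locally_injective[OF f(1) U(2,1) f(3)] by blast
  \<comment> \<open>Half the radius puts the closed disc inside the ball where \<open>f\<close> is
    injective, so \<open>f\<close> has no zero on the circle.\<close>
  define \<rho> where "\<rho> = r / 2"
  have \<rho>: "\<rho> > 0" "cball t \<rho> \<subseteq> ball t r"
    using r(1) by (auto simp: \<rho>_def)
  have cont: "continuous_on (cball t \<rho>) f" "continuous_on (cball t \<rho>) e"
    using f(1) e \<rho>(2) r(2) by (meson continuous_on_subset holomorphic_on_imp_continuous_on order.trans)+
  have nz: "f z \<noteq> 0" if "z \<in> sphere t \<rho>" for z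
  proof
    assume "f z = 0"
    then have "z = t"
      using inj_onD[OF r(3), of z t] that f(2) \<rho> r(1) by (auto simp: \<rho>_def)
    with that \<rho>(1) show False by simp
  qed
  have ne: "sphere t \<rho> \<noteq> {}"
    using \<rho>(1) by simp
  obtain z0 where z0: "z0 \<in> sphere t \<rho>" "\<And>z. z \<in> sphere t \<rho> \<Longrightarrow> cmod (f z0) \<le> cmod (f z)"
    using continuous_attains_inf[OF compact_sphere ne, of "\<lambda>z. cmod (f z)"] cont(1)
      continuous_on_subset[OF _ sphere_cball] continuous_on_norm by blast
  define \<mu> where "\<mu> = cmod (f z0)"
  have \<mu>: "\<mu> > 0" using nz[OF z0(1)] by (simp add: \<mu>_def)
  have "bounded (e ` cball t \<rho>)"
    using cont(2) compact_cball compact_continuous_image compact_imp_bounded by blast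
  then obtain M where M: "M > 0" "\<And>z. z \<in> cball t \<rho> \<Longrightarrow> cmod (e z) \<le> M"
    by (auto simp: bounded_pos)
  \<comment> \<open>With this bound the perturbed modulus is below \<open>\<mu> / 2\<close> at the
    centre, where \<open>f\<close> vanishes, and above \<open>\<mu> / 2\<close> on the
    circle.\<close>
  have "\<forall>\<^sub>F s in at 0. cmod s < \<mu> / (2 * M)"
    using \<mu> M(1) eventually_at_ball[of "\<mu> / (2 * M)" "0::complex" UNIV] by simp
  then show ?thesis
  proof eventually_elim
    case (elim s)
    then have s: "cmod s * M < \<mu> / 2"
      using M(1) by (simp add: field_simps)
    have small: "cmod (s * e z) \<le> cmod s * M" if "z \<in> cball t \<rho>" for z
      using M(2)[OF that] by (simp add: norm_mult mult_left_mono)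
    obtain t' where "t' \<in> ball t \<rho>" "f t' + s * e t' = 0"
    proof (rule holomorphic_contract_to_zero[of t \<rho> "\<lambda>z. f z + s * e z"])
      show "continuous_on (cball t \<rho>) (\<lambda>z. f z + s * e z)"
        by (intro continuous_intros cont)
      show "(\<lambda>z. f z + s * e z) holomorphic_on ball t \<rho>"
        using f(1) e \<rho>(2) r(2) ball_subset_cball[of t \<rho>]
        by (intro holomorphic_intros) (meson holomorphic_on_subset order.trans)+
      fix z assume "cmod (t - z) = \<rho>"
      then have z: "z \<in> sphere t \<rho>" by (simp add: dist_norm)
      have "\<mu> \<le> cmod (f z)"
        using z0(2)[OF z] by (simp add: \<mu>_def)
      moreover have "cmod (f z) - cmod (s * e z) \<le> cmod (f z + s * e z)"
        by (rule norm_diff_ineq)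
      moreover have "cmod (s * e z) \<le> cmod s * M" "cmod (s * e t) \<le> cmod s * M"
        using small[of z] small[of t] z \<rho>(1) by auto
      ultimately show "cmod (f t + s * e t) < cmod (f z + s * e z)"
        using s f(2) by simp
    qed (use \<rho> in auto)
    then show ?case
      using \<rho>(2) r(2) ball_subset_cball[of t \<rho>] by blast
  qed
qed

lemma finite_separation:
  fixes T :: "'a::metric_space set"
  assumes "finite T"
  obtains d where "d > 0" "\<And>x y. x \<in> T \<Longrightarrow> y \<in> T \<Longrightarrow> x \<noteq> y \<Longrightarrow> d \<le> dist x y"
proof -
  \<comment> \<open>The extra 1 keeps the minimum defined when \<open>T\<close> has at most one
    point.\<close>
  let ?S = "insert 1 ((\<lambda>(x, y). dist x y) ` {(x, y) \<in> T \<times> T. x \<noteq> y})"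
  have "finite {(x, y) \<in> T \<times> T. x \<noteq> y}"
    by (rule finite_subset[of _ "T \<times> T"]) (use assms in auto)
  then have fin: "finite ?S" by simp
  have "Min ?S > 0"
    using fin by (subst Min_gr_iff) auto
  moreover have "Min ?S \<le> dist x y" if "x \<in> T" "y \<in> T" "x \<noteq> y" for x y
    using fin that by (intro Min_le) (auto intro!: image_eqI[of _ _ "(x, y)"])
  ultimately show thesis using that by blast
qed

text \<open>A holomorphic disc in \<open>V\<close> through \<open>q\<close> suffices as a witness,
  so nothing is asked of \<open>V\<close> itself near \<open>q\<close>, which may be a singular
  point.\<close>

definition transversal_point :: "(complex ^ 'n) set \<Rightarrow> 'n \<Rightarrow> complex ^ 'n \<Rightarrow> bool" where
  "transversal_point V p q \<longleftrightarrow>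
     (\<exists>D \<gamma> t. open D \<and> t \<in> D \<and> (\<forall>i. (\<lambda>s. \<gamma> s $ i) holomorphic_on D) \<and> \<gamma> ` D \<subseteq> V \<and>
        \<gamma> t = q \<and> deriv (\<lambda>s. \<gamma> s $ p) t \<noteq> 0)"

text \<open>The vector \<open>a\<close> encodes the hyperplane \<open>z $ p = q $ p\<close>. Pulled
  back to the disc, the equation of the hyperplane \<open>a + s b\<close> is
  \<open>f + s e = 0\<close>, where \<open>f\<close> has a simple zero at the parameter of
  \<open>q\<close>. Shrinking the disc into the preimage of a ball keeps the new zero close to
  \<open>q\<close>.\<close>

lemma transversal_point_persists:
  assumes q: "transversal_point V p q" and d: "d > 0"
    and a: "a = (\<chi> i. case i of None \<Rightarrow> - (q $ p) | Some j \<Rightarrow> if j = p then 1 else 0)"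
  shows "\<forall>\<^sub>F s in at 0. \<exists>y\<in>V \<inter> affine_hyperplane (\<chi> i. a $ i + s * b $ i). dist q y < d"
proof -
  obtain D \<gamma> t where D: "open D" "t \<in> D" and hol: "\<And>i. (\<lambda>s. \<gamma> s $ i) holomorphic_on D"
      and V: "\<gamma> ` D \<subseteq> V" and t: "\<gamma> t = q" "deriv (\<lambda>s. \<gamma> s $ p) t \<noteq> 0"
    using q unfolding transversal_point_def by blast
  have "continuous_on D (\<lambda>s. \<chi> i. \<gamma> s $ i)"
    by (intro continuous_on_vec_lambda holomorphic_on_imp_continuous_on hol)
  then have "continuous_on D \<gamma>" by simp
  then have opn: "open (D \<inter> \<gamma> -` ball q d)"
    using D(1) by (intro continuous_open_preimage) auto
  define f where "f s = \<gamma> s $ p - q $ p" for s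
  define e where "e s = b $ None + (\<Sum>j\<in>UNIV. b $ Some j * \<gamma> s $ j)" for s
  have "\<forall>\<^sub>F s in at 0. \<exists>t'\<in>D \<inter> \<gamma> -` ball q d. f t' + s * e t' = 0"
  proof (rule simple_zero_persists[OF opn])
    have D': "D \<inter> \<gamma> -` ball q d \<subseteq> D" by blast
    show "t \<in> D \<inter> \<gamma> -` ball q d" using D(2) d t by simp
    show "f holomorphic_on D \<inter> \<gamma> -` ball q d" "e holomorphic_on D \<inter> \<gamma> -` ball q d"
      unfolding f_def e_def by (intro holomorphic_intros holomorphic_on_subset[OF hol D'])+
    show "f t = 0" using t by (simp add: f_def)
    have "((\<lambda>s. \<gamma> s $ p) has_field_derivative deriv (\<lambda>s. \<gamma> s $ p) t) (at t)"
      using hol D holomorphic_derivI by blast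
    then have "(f has_field_derivative deriv (\<lambda>s. \<gamma> s $ p) t) (at t)"
      unfolding f_def by (auto intro!: derivative_eq_intros)
    then show "deriv f t \<noteq> 0"
      using t(2) by (simp add: DERIV_imp_deriv)
  qed
  then show ?thesis
  proof eventually_elim
    case (elim s)
    then obtain t' where t': "t' \<in> D" "dist q (\<gamma> t') < d" "f t' + s * e t' = 0" by auto
    have "(\<Sum>j\<in>UNIV. (a $ Some j + s * b $ Some j) * \<gamma> t' $ j)
        = \<gamma> t' $ p + s * (\<Sum>j\<in>UNIV. b $ Some j * \<gamma> t' $ j)"
      by (simp add: a distrib_right sum.distrib sum_distrib_left mult.assoc if_distrib[of "\<lambda>x. x * _"] cong: if_cong)
    then have "\<gamma> t' \<in> affine_hyperplane (\<chi> i. a $ i + s * b $ i)"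
      using t'(3) by (simp add: affine_hyperplane_def a f_def e_def algebra_simps)
    with t' V show ?case by blast
  qed
qed

text \<open>The hyperplane \<open>z $ p = w\<close> may be exceptional and its intersection with
  \<open>V\<close> infinite; even then every finite set of transversal points obeys the bound. Each
  point moves by less than half the minimal distance within \<open>T\<close>, so the perturbed
  points remain distinct.\<close>

lemma card_transversal_points_le:
  assumes deg: "curve_has_degree V k" and T: "finite T"
    and q: "\<And>q. q \<in> T \<Longrightarrow> transversal_point V p q" "\<And>q. q \<in> T \<Longrightarrow> q $ p = w"
  shows "card T \<le> k"
proof -
  obtain P c where P: "polynomial_fun P" "P c \<noteq> 0"
      and card: "\<And>a. P a \<noteq> 0 \<Longrightarrow> finite (V \<inter> affine_hyperplane a) \<and> card (V \<inter> affine_hyperplane a) = k"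
    using deg unfolding curve_has_degree_def by blast
  obtain d where d: "d > 0" "\<And>x y. x \<in> T \<Longrightarrow> y \<in> T \<Longrightarrow> x \<noteq> y \<Longrightarrow> d \<le> dist x y"
    using finite_separation[OF T] by metis
  define a :: "complex ^ ('a option)" where "a = (\<chi> i. case i of None \<Rightarrow> - w | Some j \<Rightarrow> if j = p then 1 else 0)"
  obtain b where b: "\<forall>\<^sub>F s in at 0. P (\<chi> i. a $ i + s * b $ i) \<noteq> 0"
    using polynomial_fun_nonzero_near[OF P] by blast
  have "\<forall>q\<in>T. \<forall>\<^sub>F s in at 0. \<exists>y\<in>V \<inter> affine_hyperplane (\<chi> i. a $ i + s * b $ i). dist q y < d / 2"
    using q d(1) by (intro ballI transversal_point_persists) (auto simp: a_def)
  then have "\<forall>\<^sub>F s in at 0. \<forall>q\<in>T. \<exists>y\<in>V \<inter> affine_hyperplane (\<chi> i. a $ i + s * b $ i). dist q y < d / 2"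
    using T by (simp add: eventually_ball_finite)
  with b have "\<forall>\<^sub>F s in at (0::complex). P (\<chi> i. a $ i + s * b $ i) \<noteq> 0 \<and>
      (\<forall>q\<in>T. \<exists>y\<in>V \<inter> affine_hyperplane (\<chi> i. a $ i + s * b $ i). dist q y < d / 2)"
    by (rule eventually_conj)
  then obtain s where s: "P (\<chi> i. a $ i + s * b $ i) \<noteq> 0"
      "\<forall>q\<in>T. \<exists>y\<in>V \<inter> affine_hyperplane (\<chi> i. a $ i + s * b $ i). dist q y < d / 2"
    using eventually_happens'[OF trivial_limit_at] by blast
  then obtain y where y: "\<And>q. q \<in> T \<Longrightarrow> y q \<in> V \<inter> affine_hyperplane (\<chi> i. a $ i + s * b $ i)"
      "\<And>q. q \<in> T \<Longrightarrow> dist q (y q) < d / 2" by metis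
  have "inj_on y T"
  proof (rule inj_onI, rule ccontr)
    fix q q' assume "q \<in> T" "q' \<in> T" "y q = y q'" "q \<noteq> q'"
    then show False
      using y(2)[of q] y(2)[of q'] d(2)[of q q'] dist_triangle2[of q q' "y q"] by simp
  qed
  moreover have "y ` T \<subseteq> V \<inter> affine_hyperplane (\<chi> i. a $ i + s * b $ i)"
    using y(1) by blast
  ultimately show ?thesis
    using card[OF s(1)] card_inj_on_le by metis
qed

section \<open>Minkowski reduced forms\<close>

definition qnorm :: "real ^ 'n ^ 'n \<Rightarrow> real ^ 'n \<Rightarrow> real" where
  "qnorm Y x = sqrt (x \<bullet> (Y *v x))"

definition pos_def :: "real ^ 'n ^ 'n \<Rightarrow> bool" where
  "pos_def Y \<longleftrightarrow> transpose Y = Y \<and> (\<forall>x. x \<noteq> 0 \<longrightarrow> x \<bullet> (Y *v x) > 0)"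

lemma pos_def_nonneg: "pos_def Y \<Longrightarrow> 0 \<le> x \<bullet> (Y *v x)"
  unfolding pos_def_def by (cases "x = 0") (auto simp: less_imp_le)

lemma pos_def_commute:
  assumes "pos_def Y" shows "y \<bullet> (Y *v x) = x \<bullet> (Y *v y)"
  using assms unfolding pos_def_def by (metis dot_lmul_matrix inner_commute transpose_matrix_vector)

lemma pos_def_cauchy_schwarz:
  assumes Y: "pos_def Y"
  shows "(x \<bullet> (Y *v y))\<^sup>2 \<le> (x \<bullet> (Y *v x)) * (y \<bullet> (Y *v y))"
proof (cases "y = 0")
  case False
  let ?a = "x \<bullet> (Y *v x)" and ?b = "x \<bullet> (Y *v y)" and ?c = "y \<bullet> (Y *v y)"
  have c: "?c > 0"
    using Y False by (simp add: pos_def_def)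
  \<comment> \<open>This is \<open>?c\<close> times the component of \<open>x\<close> orthogonal to
    \<open>y\<close>; the scaling avoids a division.\<close>
  have "0 \<le> (?c *\<^sub>R x - ?b *\<^sub>R y) \<bullet> (Y *v (?c *\<^sub>R x - ?b *\<^sub>R y))"
    by (rule pos_def_nonneg[OF Y])
  also have "\<dots> = ?c * (?a * ?c - ?b\<^sup>2)"
    by (simp add: matrix_vector_mult_diff_distrib matrix_vector_mult_scaleR inner_diff_left inner_diff_right
        pos_def_commute[OF Y, of y x] algebra_simps power2_eq_square)
  finally show ?thesis
    using c by (simp add: zero_le_mult_iff)
qed simp

lemma qnorm_nonneg: "pos_def Y \<Longrightarrow> 0 \<le> qnorm Y x"
  by (simp add: qnorm_def pos_def_nonneg)

lemma qnorm_power2: "pos_def Y \<Longrightarrow> (qnorm Y x)\<^sup>2 = x \<bullet> (Y *v x)"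
  by (simp add: qnorm_def pos_def_nonneg)

lemma qnorm_scaleR: "qnorm Y (c *\<^sub>R x) = \<bar>c\<bar> * qnorm Y x"
  by (simp add: qnorm_def matrix_vector_mult_scaleR real_sqrt_mult mult.assoc[symmetric])

lemma qnorm_triangle:
  assumes Y: "pos_def Y" shows "qnorm Y (x + y) \<le> qnorm Y x + qnorm Y y"
proof (rule power2_le_imp_le)
  have "x \<bullet> (Y *v y) \<le> qnorm Y x * qnorm Y y"
    unfolding qnorm_def real_sqrt_mult[symmetric]
    by (rule real_le_rsqrt) (rule pos_def_cauchy_schwarz[OF Y])
  then show "(qnorm Y (x + y))\<^sup>2 \<le> (qnorm Y x + qnorm Y y)\<^sup>2"
    by (simp add: qnorm_power2[OF Y] power2_sum matrix_vector_right_distrib inner_add_left inner_add_right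
        pos_def_commute[OF Y, of y x])
qed (use Y in \<open>simp add: qnorm_nonneg\<close>)

lemma qnorm_zero [simp]: "qnorm Y 0 = 0"
  by (simp add: qnorm_def)

lemma qnorm_axis: "qnorm Y (axis i 1) = sqrt (Y $ i $ i)"
  by (simp add: qnorm_def matrix_vector_mul_component inner_axis' inner_axis)

lemma pos_def_diag: "pos_def Y \<Longrightarrow> 0 < Y $ i $ i"
  unfolding pos_def_def
  by (drule conjunct2, drule spec[of _ "axis i 1"]) (simp add: matrix_vector_mul_component inner_axis' inner_axis)

lemma qnorm_le_sum:
  assumes Y: "pos_def Y" shows "qnorm Y x \<le> (\<Sum>i\<in>UNIV. \<bar>x $ i\<bar> * sqrt (Y $ i $ i))"
proof -
  have "qnorm Y (\<Sum>i\<in>S. f i) \<le> (\<Sum>i\<in>S. qnorm Y (f i))" if "finite S" for S and f :: "'a \<Rightarrow> real ^ 'a"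
    using that by induction (auto intro: order.trans[OF qnorm_triangle[OF Y]])
  from this[of UNIV "\<lambda>i. x $ i *\<^sub>R axis i 1"] show ?thesis
    using basis_expansion[of x] by (simp add: qnorm_scaleR qnorm_axis scalar_mult_eq_scaleR)
qed

lemma minkowski_reduced_le_qnorm:
  assumes "minkowski_reduced Y" "(GCD i\<in>{k..}. a $ i) = 1"
  shows "sqrt (Y $ k $ k) \<le> qnorm Y (\<chi> i. of_int (a $ i))"
  using assms unfolding minkowski_reduced_def Let_def qnorm_def by (simp add: real_sqrt_le_mono)

text \<open>The basis vector of index \<open>j\<close> is admissible in the reduction condition for
  \<open>i\<close>, because its entry 1 lies among the indices from \<open>i\<close> on.\<close>

lemma minkowski_reduced_mono:
  assumes "minkowski_reduced Y" "i \<le> j" shows "Y $ i $ i \<le> Y $ j $ j"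
proof -
  let ?a = "\<chi> l. if l = j then 1 else (0 :: int)"
  have "Gcd ((\<lambda>l. ?a $ l) ` {i..}) dvd 1"
    using assms(2) by (intro Gcd_dvd) (auto intro!: image_eqI[of _ _ j])
  then have "(GCD l\<in>{i..}. ?a $ l) = 1"
    by (metis abs_of_nonneg Gcd_int_greater_eq_0 zdvd1_eq)
  moreover have "(\<chi> l. of_int (?a $ l)) = (axis j 1 :: real ^ ('a::{finite,linorder}))"
    by (simp add: vec_eq_iff axis_def)
  ultimately have "sqrt (Y $ i $ i) \<le> qnorm Y (axis j 1)"
    using minkowski_reduced_le_qnorm[OF assms(1), where k = i and a = ?a] by simp
  then show ?thesis
    by (simp add: qnorm_axis)
qed

section \<open>Lengths of integral vectors\<close>

lemma one_le_twice_card: "1 \<le> 2 * real CARD('g::finite)"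
  using zero_less_card_finite[where 'a = 'g] by linarith

text \<open>
  The index \<open>j\<close> begins a block of comparable lengths ending in \<open>k\<close>: up to a constant, \<open>n j\<close> is as large
  as \<open>n k\<close>, while the lengths before \<open>j\<close> are so small that reducing a lattice vector modulo the
  corresponding basis vectors costs at most half of \<open>n j\<close>.
\<close>

lemma gap_index:
  fixes n :: "'g::{finite,linorder} \<Rightarrow> real"
  assumes mono: "\<And>i j. i \<le> j \<Longrightarrow> n i \<le> n j" and pos: "\<And>i. 0 \<le> n i"
  shows "\<exists>j\<le>k. 2 * (\<Sum>i<j. n i) \<le> n j \<and> n k \<le> (2 * real CARD('g)) ^ card {..<k} * n j"
proof (induction "card {..<k}" arbitrary: k rule: less_induct)
  case less
  show ?case
  proof (cases "2 * (\<Sum>i<k. n i) \<le> n k")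
    case True
    have "n k \<le> (2 * real CARD('g)) ^ card {..<k} * n k"
      using pos[of k] by (metis mult_1 mult_right_mono one_le_power one_le_twice_card)
    with True show ?thesis by blast
  next
    case False
    then have ne: "{..<k} \<noteq> {}"
      using pos[of k] by (cases "{..<k} = {}") auto
    \<comment> \<open>The predecessor of \<open>k\<close>, which exists because the gap condition
      holds trivially at the least index. Its failure at \<open>k\<close> gives
      \<open>n k \<le> 2 g * n i\<close>, so each step back costs one factor
      \<open>2 g\<close>.\<close>
    define i where "i = Max {..<k}"
    have i: "i < k" "\<And>l. l < k \<Longrightarrow> l \<le> i"
      using ne Max_in[of "{..<k}"] by (auto simp: i_def)
    have c: "card {..<i} < card {..<k}"
      using i by (intro psubset_card_mono) auto
    from less[OF this] obtain j where j: "j \<le> i" "2 * (\<Sum>i<j. n i) \<le> n j"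
        "n i \<le> (2 * real CARD('g)) ^ card {..<i} * n j" by blast
    have "(\<Sum>l<k. n l) \<le> real (card {..<k}) * n i"
      using i mono by (intro sum_bounded_above) auto
    also have "\<dots> \<le> real CARD('g) * n i"
      using pos by (intro mult_right_mono) (auto intro!: card_mono)
    finally have "n k \<le> (2 * real CARD('g)) * n i"
      using False by simp
    also have "\<dots> \<le> (2 * real CARD('g)) * ((2 * real CARD('g)) ^ card {..<i} * n j)"
      using j(3) by (intro mult_left_mono) auto
    also have "\<dots> = (2 * real CARD('g)) ^ Suc (card {..<i}) * n j"
      by simp
    also have "\<dots> \<le> (2 * real CARD('g)) ^ card {..<k} * n j"
      using c pos by (intro mult_right_mono power_increasing one_le_twice_card) (auto simp: Suc_le_eq)
    finally show ?thesis
      using j i by (meson less_imp_le order.trans)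
  qed
qed

text \<open>If \<open>e\<close> is the gcd of the quotients, then \<open>e * d\<close> is a common
  divisor of the \<open>v i\<close> and hence divides \<open>d\<close>; cancelling the nonzero
  \<open>d\<close> leaves \<open>e dvd 1\<close>.\<close>

lemma GCD_div_GCD:
  fixes v :: "'i \<Rightarrow> int"
  assumes "k \<in> A" "v k \<noteq> 0"
  shows "(GCD i\<in>A. v i div (GCD i\<in>A. v i)) = 1"
proof -
  define d where "d = (GCD i\<in>A. v i)"
  let ?e = "GCD i\<in>A. v i div d"
  have dv: "d dvd v i" if "i \<in> A" for i
    unfolding d_def using that by (intro Gcd_dvd) auto
  have d0: "d \<noteq> 0"
    using dv[OF assms(1)] assms(2) by auto
  have "?e * d dvd v i" if "i \<in> A" for i
  proof -
    have "?e dvd v i div d"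
      using that by (intro Gcd_dvd) auto
    then show ?thesis
      using dv[OF that] by (metis dvd_div_mult_self mult_dvd_mono dvd_refl)
  qed
  then have "?e * d dvd d"
    unfolding d_def by (intro Gcd_greatest) auto
  then have "?e dvd 1"
    using d0 by (metis dvd_times_right_cancel_iff mult_1)
  then show ?thesis
    unfolding d_def[symmetric] by (metis abs_of_nonneg Gcd_int_greater_eq_0 zdvd1_eq)
qed

text \<open>
  Divide \<open>v\<close> componentwise by the greatest common divisor \<open>d\<close> of its components from \<open>j\<close> on: the
  quotient is admissible in the reduction condition for \<open>j\<close>, and the remainder only involves the
  short basis vectors before \<open>j\<close>.
\<close>

lemma qnorm_integral_ge:
  fixes Y :: "real ^ ('g::{finite,linorder}) ^ ('g::{finite,linorder})" and v :: "int ^ ('g::{finite,linorder})"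
  assumes Y: "pos_def Y" and red: "minkowski_reduced Y" and v: "v $ k \<noteq> 0"
  shows "sqrt (Y $ k $ k) \<le> 2 * (2 * real CARD('g)) ^ CARD('g) * qnorm Y (\<chi> i. of_int (v $ i))"
proof -
  define n where "n i = sqrt (Y $ i $ i)" for i
  let ?r = "\<lambda>a :: int ^ ('g::{finite,linorder}). (\<chi> i. of_int (a $ i)) :: real ^ ('g::{finite,linorder})"
  have n0: "0 \<le> n i" for i
    using pos_def_diag[OF Y, of i] by (simp add: n_def)
  obtain j where j: "j \<le> k" "2 * (\<Sum>i<j. n i) \<le> n j" "n k \<le> (2 * real CARD('g)) ^ card {..<k} * n j"
    using gap_index[of n k] n0 minkowski_reduced_mono[OF red] by (auto simp: n_def)
  define d where "d = (GCD i\<in>{j..}. v $ i)"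
  define w where "w = (\<chi> i. v $ i div d)"
  have dv: "d dvd v $ i" if "i \<ge> j" for i
    unfolding d_def using that by (intro Gcd_dvd) auto
  have "d \<noteq> 0"
    using dv[OF j(1)] v by auto
  moreover have "d \<ge> 0"
    unfolding d_def by (rule Gcd_int_greater_eq_0)
  ultimately have d: "d \<ge> 1" by simp
  have "(GCD i\<in>{j..}. w $ i) = 1"
    unfolding w_def d_def using GCD_div_GCD[of k "{j..}" "\<lambda>i. v $ i"] j(1) v by simp
  then have "n j \<le> qnorm Y (?r w)"
    unfolding n_def by (rule minkowski_reduced_le_qnorm[OF red])
  then have "d * n j \<le> qnorm Y (of_int d *\<^sub>R ?r w)"
    using d by (simp add: qnorm_scaleR)
  also have "of_int d *\<^sub>R ?r w = ?r v + - (\<chi> i. of_int (v $ i mod d))"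
  proof -
    have "of_int (v $ i) = of_int d * of_int (v $ i div d) + (of_int (v $ i mod d) :: real)" for i
      by (metis mult_div_mod_eq of_int_add of_int_mult)
    then show ?thesis by (simp add: vec_eq_iff w_def)
  qed
  also have "qnorm Y \<dots> \<le> qnorm Y (?r v) + qnorm Y (- (\<chi> i. of_int (v $ i mod d)))"
    by (rule qnorm_triangle[OF Y])
  also have "qnorm Y (- (\<chi> i. of_int (v $ i mod d))) \<le> (\<Sum>i\<in>UNIV. \<bar>of_int (v $ i mod d)\<bar> * n i)"
    using qnorm_le_sum[OF Y, of "- (\<chi> i. of_int (v $ i mod d))"] by (simp add: n_def)
  also have "\<dots> = (\<Sum>i<j. \<bar>of_int (v $ i mod d)\<bar> * n i)"
    using dv by (intro sum.mono_neutral_right) (auto simp: not_less dvd_imp_mod_0)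
  also have "\<dots> \<le> (\<Sum>i<j. d * n i)"
  proof (intro sum_mono mult_right_mono n0)
    fix i
    have "0 \<le> v $ i mod d" "v $ i mod d \<le> d"
      using d by (auto intro: less_imp_le)
    then show "\<bar>real_of_int (v $ i mod d)\<bar> \<le> d" by linarith
  qed
  \<comment> \<open>The gap before \<open>j\<close> makes the remainder at most half of
    \<open>d * n j\<close>, so it can be absorbed on the left.\<close>
  also have "\<dots> \<le> d * (n j / 2)"
    using j(2) d by (simp add: sum_distrib_left[symmetric])
  finally have "d * n j \<le> 2 * qnorm Y (?r v)" by simp
  moreover have "n j \<le> d * n j"
    using mult_right_mono[of 1 "real_of_int d" "n j"] d n0[of j] by simp
  ultimately have "n j \<le> 2 * qnorm Y (?r v)" by linarith
  moreover have "(2 * real CARD('g)) ^ card {..<k} \<le> (2 * real CARD('g)) ^ CARD('g)"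
    by (intro power_increasing one_le_twice_card card_mono) auto
  ultimately have "(2 * real CARD('g)) ^ card {..<k} * n j \<le> (2 * real CARD('g)) ^ CARD('g) * (2 * qnorm Y (?r v))"
    using n0 by (intro mult_mono) auto
  then show ?thesis
    using j(3) by (simp add: n_def mult_ac)
qed

section \<open>From integral to real vectors\<close>

lemma Dirichlet_approx_vec:
  fixes x :: "real ^ 'n" and N :: nat
  assumes "N > 0"
  obtains m :: int and p :: "int ^ 'n"
    where "0 < m" "m \<le> int N ^ CARD('n)" "\<And>i. \<bar>m * x $ i - p $ i\<bar> < 1 / N"
proof -
  obtain e :: "nat \<Rightarrow> 'n" where e: "bij_betw e {..<CARD('n)} UNIV"
    using ex_bij_betw_nat_finite[of "UNIV :: 'n set"] by (auto simp: atLeast0LessThan)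
  obtain m p where m: "0 < m" "m \<le> int (N ^ CARD('n))"
      and p: "\<And>i. i < CARD('n) \<Longrightarrow> \<bar>of_int m * (x $ e i) - of_int (p i)\<bar> < 1 / N"
    using Dirichlet_approx_simult[OF assms, of "CARD('n)" "\<lambda>i. x $ e i"] by blast
  let ?e' = "the_inv_into {..<CARD('n)} e"
  have "?e' i < CARD('n)" "e (?e' i) = i" for i
    using the_inv_into_into[OF bij_betw_imp_inj_on[OF e], of i, OF _ subset_refl]
      f_the_inv_into_f_bij_betw[OF e] e by (auto simp: bij_betw_def)
  then show thesis
    using that[of m "\<chi> i. p (?e' i)"] m p[of "?e' _"] by simp
qed

text \<open>With \<open>K = (2 g)^g\<close>, half the factor in \<open>qnorm_integral_ge\<close>,
  this is \<open>4 K N^g\<close> for \<open>N = 4 K g\<close>. This \<open>N\<close> makes the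
  approximation error at most \<open>n k / (4 K)\<close> in length, and \<open>N^g\<close> bounds
  the multiplier in Dirichlet's theorem.\<close>

definition reduction_const :: "nat \<Rightarrow> real" where
  "reduction_const g = 4 * (2 * real g) ^ g * real (4 * (2 * g) ^ g * g) ^ g"

lemma reduction_const_pos: "g > 0 \<Longrightarrow> 0 < reduction_const g"
  by (simp add: reduction_const_def)

text \<open>
  After scaling to \<open>x $ k = 1\<close>, simultaneous approximation gives a bounded multiple of \<open>x\<close> close to a
  lattice vector, whose length is bounded below.
\<close>

lemma top_coordinate_le_qnorm:
  fixes Y :: "real ^ ('g::{finite,linorder}) ^ ('g::{finite,linorder})"
  assumes Y: "pos_def Y" and red: "minkowski_reduced Y" and x: "\<And>i. i > k \<Longrightarrow> x $ i = 0"
  shows "sqrt (Y $ k $ k) * \<bar>x $ k\<bar> \<le> reduction_const CARD('g) * qnorm Y x"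
proof -
  let ?g = "CARD('g)"
  define n where "n i = sqrt (Y $ i $ i)" for i
  define K where "K = (2 * real ?g) ^ ?g"
  define N where "N = 4 * (2 * ?g) ^ ?g * ?g"
  have N0: "N > 0" by (simp add: N_def)
  have NK: "real N = 4 * K * ?g" by (simp add: N_def K_def)
  have K: "K > 0" by (simp add: K_def)
  have n0: "0 \<le> n i" for i
    using pos_def_diag[OF Y, of i] by (simp add: n_def)
  have nmono: "i \<le> j \<Longrightarrow> n i \<le> n j" for i j
    using minkowski_reduced_mono[OF red] by (auto simp: n_def)
  have one: "n k \<le> reduction_const ?g * qnorm Y y" if y: "\<And>i. i > k \<Longrightarrow> y $ i = 0" "y $ k = 1" for y
  proof -
    obtain m p where m: "0 < m" "m \<le> int N ^ ?g" and p: "\<And>i. \<bar>of_int m * y $ i - of_int (p $ i)\<bar> < 1 / N"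
      using Dirichlet_approx_vec[OF N0, of y] by blast
    \<comment> \<open>The entries from \<open>k\<close> on are matched exactly, so the error lives
      on indices below \<open>k\<close>, where the basis vectors are no longer than
      \<open>n k\<close>.\<close>
    define v where "v = (\<chi> i. if i = k then m else if i > k then 0 else p $ i)"
    let ?v = "(\<chi> i. of_int (v $ i)) :: real ^ ('g::{finite,linorder})"
    define r where "r = ?v - of_int m *\<^sub>R y"
    have r: "r $ i = 0 \<or> i < k \<and> \<bar>r $ i\<bar> \<le> 1 / N" for i
      using p[of i] y by (auto simp: r_def v_def abs_minus_commute less_imp_le)
    have "qnorm Y r \<le> (\<Sum>i\<in>UNIV. \<bar>r $ i\<bar> * n i)"
      using qnorm_le_sum[OF Y] by (simp add: n_def)
    also have "\<dots> \<le> (\<Sum>i\<in>(UNIV::'g set). 1 / N * n k)"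
    proof (rule sum_mono)
      fix i show "\<bar>r $ i\<bar> * n i \<le> 1 / N * n k"
      proof (cases "r $ i = 0")
        case True
        then show ?thesis using n0[of k] by simp
      next
        case False
        then show ?thesis
          using r[of i] n0[of i] nmono[of i k] N0 by (intro mult_mono) auto
      qed
    qed
    also have "\<dots> = n k / (4 * K)"
      using N0 by (simp add: NK)
    finally have r': "qnorm Y r \<le> n k / (4 * K)" .
    have "v $ k \<noteq> 0" using m by (simp add: v_def)
    then have "n k \<le> 2 * K * qnorm Y ?v"
      unfolding n_def K_def by (rule qnorm_integral_ge[OF Y red])
    also have "?v = of_int m *\<^sub>R y + r" by (simp add: r_def)
    also have "qnorm Y \<dots> \<le> of_int m * qnorm Y y + n k / (4 * K)"
      using qnorm_triangle[OF Y, of "of_int m *\<^sub>R y" r] r' m by (simp add: qnorm_scaleR)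
    finally have "n k \<le> 2 * K * (of_int m * qnorm Y y + n k / (4 * K))"
      using K by simp
    \<comment> \<open>The error contributes \<open>n k / 2\<close>, which is absorbed on the left
      and doubles the factor.\<close>
    then have "n k \<le> 4 * K * (of_int m * qnorm Y y)"
      using K by (simp add: distrib_left)
    also have "of_int m * qnorm Y y \<le> real N ^ ?g * qnorm Y y"
    proof (rule mult_right_mono)
      show "real_of_int m \<le> real N ^ ?g"
        using m(2) by (metis of_int_le_iff of_int_of_nat_eq of_int_power)
    qed (rule qnorm_nonneg[OF Y])
    finally show ?thesis
      using K by (simp add: reduction_const_def K_def N_def mult_ac)
  qed
  show ?thesis
  proof (cases "x $ k = 0")
    case True
    then show ?thesis
      using qnorm_nonneg[OF Y, of x] reduction_const_pos[of ?g] by simp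
  next
    case False
    have "n k \<le> reduction_const ?g * qnorm Y ((1 / x $ k) *\<^sub>R x)"
      using False x by (intro one) auto
    then show ?thesis
      using False by (simp add: qnorm_scaleR n_def field_simps)
  qed
qed

definition reduction_const' :: "nat \<Rightarrow> real" where
  "reduction_const' g = reduction_const g * (1 + reduction_const g) ^ g"

text \<open>Induction on the size of the support. The bound for the top coordinate also bounds the
  length of its part of \<open>x\<close>, so removing that part enlarges the norm by at most
  \<open>1 + c\<close>. At most \<open>g\<close> removals explain the power in
  \<open>reduction_const'\<close>.\<close>

lemma coordinate_le_qnorm:
  fixes Y :: "real ^ ('g::{finite,linorder}) ^ ('g::{finite,linorder})"
  assumes Y: "pos_def Y" and red: "minkowski_reduced Y"
  shows "sqrt (Y $ i $ i) * \<bar>x $ i\<bar> \<le> reduction_const' CARD('g) * qnorm Y x"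
proof -
  define c where "c = reduction_const CARD('g)"
  have c: "c > 0" by (simp add: c_def reduction_const_pos)
  have ind: "sqrt (Y $ i $ i) * \<bar>x $ i\<bar> \<le> c * (1 + c) ^ card {i. x $ i \<noteq> 0} * qnorm Y x" for x i
  proof (induction "card {i. x $ i \<noteq> 0}" arbitrary: x i)
    case 0
    then have "x $ i = 0" by auto
    then show ?case
      using c qnorm_nonneg[OF Y, of x] by simp
  next
    case (Suc m)
    define k where "k = Max {i. x $ i \<noteq> 0}"
    have "{i. x $ i \<noteq> 0} \<noteq> {}"
      using Suc(2) by (metis card.empty nat.distinct(1))
    then have k: "x $ k \<noteq> 0" "\<And>i. i > k \<Longrightarrow> x $ i = 0"
      using Max_in[of "{i. x $ i \<noteq> 0}"] Max_ge[of "{i. x $ i \<noteq> 0}"] by (auto simp: k_def not_less)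
    have top: "sqrt (Y $ k $ k) * \<bar>x $ k\<bar> \<le> c * qnorm Y x"
      unfolding c_def by (rule top_coordinate_le_qnorm[OF Y red k(2)])
    define y where "y = x + (- x $ k) *\<^sub>R axis k 1"
    have "{i. y $ i \<noteq> 0} = {i. x $ i \<noteq> 0} - {k}"
      by (auto simp: y_def axis_def)
    then have m: "m = card {i. y $ i \<noteq> 0}"
      using Suc(2) k(1) by simp
    have ny: "qnorm Y y \<le> (1 + c) * qnorm Y x"
      using qnorm_triangle[OF Y, of x "(- x $ k) *\<^sub>R axis k 1"] top
      by (simp add: y_def qnorm_scaleR qnorm_axis algebra_simps del: scaleR_minus_left)
    have q0: "0 \<le> qnorm Y x" by (rule qnorm_nonneg[OF Y])
    have p1: "1 \<le> (1 + c) ^ Suc m"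
      using c by (intro one_le_power) simp
    show ?case
    proof (cases "i = k")
      case True
      have "c * qnorm Y x * 1 \<le> c * qnorm Y x * (1 + c) ^ Suc m"
        using c q0 p1 by (intro mult_left_mono) auto
      then show ?thesis
        using top True by (simp add: Suc(2)[symmetric] mult_ac)
    next
      case False
      then have "sqrt (Y $ i $ i) * \<bar>x $ i\<bar> = sqrt (Y $ i $ i) * \<bar>y $ i\<bar>"
        by (simp add: y_def axis_def)
      also have "\<dots> \<le> c * (1 + c) ^ m * qnorm Y y"
        using Suc(1)[OF m] m by simp
      also have "\<dots> \<le> c * (1 + c) ^ m * ((1 + c) * qnorm Y x)"
        using ny c by (intro mult_left_mono) auto
      finally show ?thesis
        by (simp add: Suc(2)[symmetric] mult_ac)
    qed
  qed
  have "c * (1 + c) ^ card {i. x $ i \<noteq> 0} * qnorm Y x \<le> c * (1 + c) ^ CARD('g) * qnorm Y x"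
    using c by (intro mult_right_mono mult_left_mono power_increasing qnorm_nonneg[OF Y]) (auto intro!: card_mono)
  with ind show ?thesis
    unfolding reduction_const'_def c_def by (meson order.trans)
qed

section \<open>The Siegel metric on the fundamental domain\<close>

lemma pos_def_matrix_inv:
  assumes Y: "pos_def Y" shows "Y ** matrix_inv Y = mat 1"
proof -
  have "\<forall>x. Y *v x = 0 \<longrightarrow> x = 0"
    using Y unfolding pos_def_def by (metis inner_zero_right less_irrefl)
  then obtain B where "B ** Y = mat 1"
    using matrix_left_invertible_ker by blast
  then have "\<exists>A'. Y ** A' = mat 1 \<and> A' ** Y = mat 1"
    using matrix_left_right_inverse by blast
  then show ?thesis
    unfolding matrix_inv_def by (rule someI2_ex) simp
qed

text \<open>The column \<open>x = Y^-1 e_j\<close> satisfies \<open>x^T Y x = x_j\<close>. The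
  coordinate bound at \<open>j\<close> therefore reads \<open>sqrt y_j * sqrt x_j \<le> c\<close>,
  and inserting this into the bound at \<open>i\<close> produces the second factor
  \<open>c\<close>.\<close>

lemma matrix_inv_entry_le:
  fixes Y :: "real ^ ('g::{finite,linorder}) ^ ('g::{finite,linorder})"
  assumes Y: "pos_def Y" and red: "minkowski_reduced Y"
  shows "sqrt (Y $ i $ i) * sqrt (Y $ j $ j) * \<bar>matrix_inv Y $ i $ j\<bar> \<le> (reduction_const' CARD('g))\<^sup>2"
proof -
  let ?R = "matrix_inv Y" and ?c = "reduction_const' CARD('g)"
  define x where "x = ?R *v axis j 1"
  have xi: "x $ i = ?R $ i $ j" for i
    by (simp add: x_def matrix_vector_mul_component inner_axis)
  have "Y *v x = axis j 1"
    by (simp add: x_def matrix_vector_mul_assoc pos_def_matrix_inv[OF Y])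
  then have q: "qnorm Y x = sqrt (x $ j)" and x0: "0 \<le> x $ j"
    using pos_def_nonneg[OF Y, of x] by (simp_all add: qnorm_def inner_axis)
  have le: "sqrt (Y $ i $ i) * \<bar>x $ i\<bar> \<le> ?c * sqrt (x $ j)" for i
    using coordinate_le_qnorm[OF Y red, of i x] by (simp add: q)
  have c: "?c > 0"
    using reduction_const_pos[of "CARD('g)"] by (simp add: reduction_const'_def)
  have "sqrt (Y $ j $ j) * sqrt (x $ j) \<le> ?c"
  proof (cases "x $ j = 0")
    case False
    have "sqrt (Y $ j $ j) * sqrt (x $ j) * sqrt (x $ j) \<le> ?c * sqrt (x $ j)"
      using le[of j] x0 by (simp add: mult.assoc)
    then show ?thesis
      using x0 False by (simp add: mult_le_cancel_right)
  qed (use c in simp)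
  then have "?c * (sqrt (Y $ j $ j) * sqrt (x $ j)) \<le> ?c * ?c"
    using c by (intro mult_left_mono) auto
  moreover have "sqrt (Y $ j $ j) * (sqrt (Y $ i $ i) * \<bar>x $ i\<bar>) \<le> sqrt (Y $ j $ j) * (?c * sqrt (x $ j))"
    using le[of i] pos_def_diag[OF Y, of j] by (intro mult_left_mono) auto
  ultimately show ?thesis
    by (simp add: xi power2_eq_square mult_ac)
qed

lemma pos_def_im_mat: "z \<in> siegel_space \<Longrightarrow> pos_def (im_mat z)"
proof -
  have "z $ Upair i j = z $ Upair j i" for i j
    by (rule arg_cong[where f = "($) z"]) simp
  then show "z \<in> siegel_space \<Longrightarrow> pos_def (im_mat z)"
    by (simp add: siegel_space_def pos_def_def im_mat_def sym_mat_def transpose_def)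
qed

text \<open>After the bounds on \<open>R\<close>, each term of the trace carries
  \<open>1 / (n i * n j * n k * n l)\<close>, which splits between its two entries of
  \<open>U\<close>. The fourfold sum becomes the square of the sum of the \<open>a j k\<close>, and
  Cauchy-Schwarz over the \<open>g^2\<close> index pairs gives the factor
  \<open>g^2\<close>.\<close>

lemma siegel_metric_le:
  fixes u :: "complex ^ ('g::{finite,linorder} uprod)"
  assumes z: "z \<in> siegel_space" and red: "minkowski_reduced (im_mat z)"
  shows "\<bar>siegel_metric z u u\<bar> \<le> reduction_const' CARD('g) ^ 4 * (real CARD('g))\<^sup>2 *
    (\<Sum>(j, k)\<in>UNIV. (cmod (u $ Upair j k))\<^sup>2 / (im_mat z $ j $ j * im_mat z $ k $ k))"
proof -
  let ?c = "reduction_const' CARD('g)"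
  define Y where "Y = im_mat z"
  define R where "R = matrix_inv Y"
  define U where "U = sym_mat u"
  define n where "n i = sqrt (Y $ i $ i)" for i
  define a where "a j k = cmod (U $ j $ k) / (n j * n k)" for j k
  have Y: "pos_def Y" unfolding Y_def by (rule pos_def_im_mat[OF z])
  have n0: "0 < n i" for i
    using pos_def_diag[OF Y, of i] by (simp add: n_def)
  have R: "\<bar>R $ i $ j\<bar> \<le> ?c\<^sup>2 / (n i * n j)" for i j
    using matrix_inv_entry_le[OF Y red[folded Y_def], of i j] n0[of i] n0[of j]
    by (simp add: R_def n_def field_simps)
  let ?R = "map_matrix of_real R :: complex ^ ('g::{finite,linorder}) ^ ('g::{finite,linorder})"
  have "\<bar>siegel_metric z u u\<bar> \<le> cmod (trace (?R ** U ** ?R ** map_matrix cnj U))"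
    by (simp add: siegel_metric_def Let_def R_def Y_def U_def abs_Re_le_cmod)
  also have "trace (?R ** U ** ?R ** map_matrix cnj U) =
      (\<Sum>i\<in>UNIV. \<Sum>l\<in>UNIV. (\<Sum>k\<in>UNIV. (\<Sum>j\<in>UNIV. of_real (R $ i $ j) * U $ j $ k) * of_real (R $ k $ l)) * cnj (U $ l $ i))"
    by (simp add: trace_def matrix_matrix_mult_def)
  also have "cmod \<dots> \<le> (\<Sum>i\<in>UNIV. \<Sum>l\<in>UNIV. (\<Sum>k\<in>UNIV. (\<Sum>j\<in>UNIV. \<bar>R $ i $ j\<bar> * cmod (U $ j $ k)) * \<bar>R $ k $ l\<bar>) * cmod (U $ l $ i))"
    by (intro order.trans[OF norm_sum] sum_mono)
      (auto simp: norm_mult intro!: mult_right_mono order.trans[OF norm_sum] sum_mono)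
  also have "\<dots> \<le> (\<Sum>i\<in>UNIV. \<Sum>l\<in>UNIV. (\<Sum>k\<in>UNIV. (\<Sum>j\<in>UNIV. ?c\<^sup>2 / (n i * n j) * cmod (U $ j $ k)) * (?c\<^sup>2 / (n k * n l))) * cmod (U $ l $ i))"
    using n0 by (intro sum_mono mult_mono R mult_nonneg_nonneg sum_nonneg) (auto simp: less_imp_le)
  also have "\<dots> = ?c ^ 4 * ((\<Sum>j\<in>UNIV. \<Sum>k\<in>UNIV. a j k) * (\<Sum>l\<in>UNIV. \<Sum>i\<in>UNIV. a l i))"
    (is "?lhs = _")
  proof -
    have "?c\<^sup>2 / (n i * n j) * cmod (U $ j $ k) * (?c\<^sup>2 / (n k * n l)) * cmod (U $ l $ i) = ?c ^ 4 * (a j k * a l i)" for i j k l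
      by (simp add: a_def power2_eq_square power4_eq_xxxx mult_ac)
    then have "?lhs = (\<Sum>i\<in>UNIV. \<Sum>l\<in>UNIV. \<Sum>k\<in>UNIV. \<Sum>j\<in>UNIV. ?c ^ 4 * (a j k * a l i))"
      by (simp only: sum_distrib_right)
    also have "\<dots> = ?c ^ 4 * ((\<Sum>k\<in>UNIV. \<Sum>j\<in>UNIV. a j k) * (\<Sum>i\<in>UNIV. \<Sum>l\<in>UNIV. a l i))"
      by (simp only: sum_distrib_left sum_distrib_right)
    also have "(\<Sum>k\<in>UNIV. \<Sum>j\<in>UNIV. a j k) = (\<Sum>j\<in>UNIV. \<Sum>k\<in>UNIV. a j k)"
      by (rule sum.swap)
    finally show ?thesis .
  qed
  also have "\<dots> = ?c ^ 4 * (\<Sum>(j, k)\<in>UNIV. a j k)\<^sup>2"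
    by (simp add: power2_eq_square sum.cartesian_product)
  also have "\<dots> \<le> ?c ^ 4 * ((\<Sum>(j, k)\<in>UNIV. (a j k)\<^sup>2) * real (card (UNIV :: ('g \<times> 'g) set)))"
    using sum_squared_le_sum_of_squares[of "\<lambda>(j, k). a j k" UNIV]
    by (intro mult_left_mono) (auto simp: case_prod_unfold)
  finally have "\<bar>siegel_metric z u u\<bar> \<le> ?c ^ 4 * ((\<Sum>(j, k)\<in>UNIV. (a j k)\<^sup>2) * real (card (UNIV :: ('g \<times> 'g) set)))" .
  moreover have "(a j k)\<^sup>2 = (cmod (u $ Upair j k))\<^sup>2 / (Y $ j $ j * Y $ k $ k)" for j k
    using pos_def_diag[OF Y, of j] pos_def_diag[OF Y, of k]
    by (simp add: a_def power_divide power_mult_distrib n_def U_def sym_mat_def)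
  ultimately show ?thesis
    by (simp add: Y_def mult_ac power2_eq_square[of "real CARD('g)"])
qed

text \<open>The factors \<open>\<i>\<close> and its conjugate cancel, so \<open>u\<close> and
  \<open>\<i> u\<close> have equal length; dropping the square of the mixed term only enlarges the
  root.\<close>

lemma area_density_siegel_metric:
  "area_density siegel_metric \<gamma> t \<le> \<bar>siegel_metric (\<gamma> t) (chart_deriv \<gamma> t) (chart_deriv \<gamma> t)\<bar>"
proof -
  let ?u = "chart_deriv \<gamma> t" and ?v = "\<chi> i. \<i> * chart_deriv \<gamma> t $ i"
  let ?G = "siegel_metric (\<gamma> t)"
  have "?G ?v ?v = ?G ?u ?u"
    by (simp add: siegel_metric_def sym_mat_def trace_def matrix_matrix_mult_def sum_distrib_left mult_ac)
  then have "area_density siegel_metric \<gamma> t \<le> sqrt ((?G ?u ?u)\<^sup>2)"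
    unfolding area_density_def Let_def by (intro real_sqrt_le_mono) (simp add: power2_eq_square)
  then show ?thesis by simp
qed

text \<open>The matrix \<open>(0 -1; 1 0)\<close> placed in the \<open>l\<close>-th coordinate plane.\<close>

definition flip_coordinate :: "'g::finite \<Rightarrow> int ^ ('g + 'g) ^ ('g + 'g)" where
  "flip_coordinate l = (\<chi> p q. case (p, q) of
     (Inl a, Inl b) \<Rightarrow> if a = b then (if a = l then 0 else 1) else 0
   | (Inl a, Inr b) \<Rightarrow> if a = b then (if a = l then - 1 else 0) else 0
   | (Inr a, Inl b) \<Rightarrow> if a = b then (if a = l then 1 else 0) else 0
   | (Inr a, Inr b) \<Rightarrow> if a = b then (if a = l then 0 else 1) else 0)"

lemma sum_UNIV_Plus:
  fixes f :: "'a::finite + 'b::finite \<Rightarrow> 'c::comm_monoid_add"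
  shows "(\<Sum>p\<in>UNIV. f p) = (\<Sum>a\<in>UNIV. f (Inl a)) + (\<Sum>b\<in>UNIV. f (Inr b))"
  by (simp add: UNIV_Plus_UNIV[symmetric] sum.Plus del: UNIV_Plus_UNIV)

lemma flip_coordinate_Sp: "flip_coordinate l \<in> Sp_int"
proof -
  let ?M = "flip_coordinate l"
  \<comment> \<open>Multiplication by the form on the left exchanges the upper and lower rows up to
    sign, which leaves a check of blocks.\<close>
  have J: "(symplectic_form ** ?M) $ p $ q = (case p of Inl a \<Rightarrow> ?M $ Inr a $ q | Inr a \<Rightarrow> - ?M $ Inl a $ q)" for p q
    by (cases p) (simp_all add: matrix_matrix_mult_def symplectic_form_def sum_UNIV_Plus if_distrib[of "\<lambda>x. x * _"] cong: if_cong)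
  have "(transpose ?M ** (symplectic_form ** ?M)) $ p $ q = symplectic_form $ p $ q" for p q
    unfolding matrix_matrix_mult_def[of "transpose ?M"] vec_lambda_beta J sum_UNIV_Plus
    by (cases p; cases q)
      (auto simp: flip_coordinate_def transpose_def symplectic_form_def if_distrib[of "\<lambda>x. x * _"]
        if_distrib[of "\<lambda>x. _ * x"] if_distrib[of uminus] cong: if_cong)
  then show ?thesis
    by (simp add: Sp_int_def vec_eq_iff matrix_mul_assoc)
qed

text \<open>Here \<open>C Z + D\<close> is the identity with row \<open>l\<close> replaced by row
  \<open>l\<close> of \<open>Z\<close>, so Cramer's rule evaluates the determinant. The last
  condition on the fundamental domain thus yields \<open>|z_ll| \<ge> 1\<close>.\<close>

lemma det_cocycle_flip_coordinate: "det (cocycle (flip_coordinate l) z) = z $ Upair l l"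
proof -
  let ?x = "\<chi> j. z $ Upair l j"
  have "cocycle (flip_coordinate l) z =
    (\<chi> i. if i = l then sum (\<lambda>i. ?x $ i *s row i (mat 1)) UNIV else row i (mat 1))"
    by (auto simp: vec_eq_iff cocycle_def flip_coordinate_def matrix_matrix_mult_def sym_mat_def row_def mat_def
        if_distrib[of "\<lambda>x. x * _"] if_distrib[of of_int] if_distrib[of "\<lambda>x. _ * x"] cong: if_cong)
  then show ?thesis
    using cramer_lemma_transpose[of l ?x "mat 1"] by simp
qed

text \<open>A function of one coordinate alone, as the change of variables \<open>w = z_jk\<close>
  requires.\<close>

definition strip_weight :: "complex \<Rightarrow> real" where
  "strip_weight w = (if \<bar>Re w\<bar> \<le> 1 / 2 then 1 / max (3 / 4) ((Im w)\<^sup>2) else 0)"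

text \<open>Since \<open>|z_ii| \<ge> 1\<close> and \<open>|Re z_ii| \<le> 1/2\<close>, each
  \<open>y_i\<close> is at least \<open>sqrt (3/4)\<close>. The bound by \<open>(Im z_jk)^2\<close>
  is Cauchy-Schwarz for two basis vectors.\<close>

lemma siegel_domain_weight:
  assumes z: "z \<in> siegel_fundamental_domain"
  shows "1 / (im_mat z $ j $ j * im_mat z $ k $ k) \<le> strip_weight (z $ Upair j k)"
proof -
  let ?Y = "im_mat z"
  have Y: "pos_def ?Y"
    using z by (intro pos_def_im_mat) (simp add: siegel_fundamental_domain_def)
  have re: "\<bar>Re (z $ Upair i j)\<bar> \<le> 1 / 2" for i j
    using z by (auto simp: siegel_fundamental_domain_def re_mat_def sym_mat_def)
  have diag: "sqrt (3 / 4) \<le> ?Y $ i $ i" for i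
  proof -
    have "1 \<le> cmod (z $ Upair i i)"
      using z flip_coordinate_Sp[of i] unfolding siegel_fundamental_domain_def
      by (metis (no_types, lifting) det_cocycle_flip_coordinate mem_Collect_eq)
    then have "1 \<le> (Re (z $ Upair i i))\<^sup>2 + (Im (z $ Upair i i))\<^sup>2"
      by (simp add: cmod_def)
    moreover have "(Re (z $ Upair i i))\<^sup>2 \<le> (1 / 2)\<^sup>2"
      using re[of i i] by (subst power2_le_iff_abs_le) auto
    ultimately have "3 / 4 \<le> (?Y $ i $ i)\<^sup>2"
      by (simp add: im_mat_def sym_mat_def power2_eq_square)
    then show ?thesis
      using pos_def_diag[OF Y, of i] by (intro real_le_lsqrt) auto
  qed
  have "3 / 4 \<le> ?Y $ j $ j * ?Y $ k $ k"
    using mult_mono[OF diag[of j] diag[of k]] pos_def_diag[OF Y, of j] by simp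
  moreover have "(Im (z $ Upair j k))\<^sup>2 \<le> ?Y $ j $ j * ?Y $ k $ k"
    using pos_def_cauchy_schwarz[OF Y, of "axis j 1" "axis k 1"]
    by (simp add: matrix_vector_mul_component inner_axis' inner_axis) (simp add: im_mat_def sym_mat_def)
  ultimately have "max (3 / 4) ((Im (z $ Upair j k))\<^sup>2) \<le> ?Y $ j $ j * ?Y $ k $ k"
    by simp
  then show ?thesis
    unfolding strip_weight_def using re[of j k] by (auto intro!: divide_left_mono mult_pos_pos pos_def_diag[OF Y])
qed

lemma area_density_le:
  fixes \<gamma> :: "complex \<Rightarrow> complex ^ ('g::{finite,linorder} uprod)"
  assumes z: "\<gamma> t \<in> siegel_fundamental_domain"
  shows "area_density siegel_metric \<gamma> t \<le> reduction_const' CARD('g) ^ 4 * (real CARD('g))\<^sup>2 *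
    (\<Sum>(j, k)\<in>UNIV. strip_weight (\<gamma> t $ Upair j k) * (cmod (deriv (\<lambda>s. \<gamma> s $ Upair j k) t))\<^sup>2)"
proof -
  let ?u = "chart_deriv \<gamma> t" and ?Y = "im_mat (\<gamma> t)"
  have "area_density siegel_metric \<gamma> t \<le> reduction_const' CARD('g) ^ 4 * (real CARD('g))\<^sup>2 *
    (\<Sum>(j, k)\<in>UNIV. (cmod (?u $ Upair j k))\<^sup>2 / (?Y $ j $ j * ?Y $ k $ k))"
    using z by (intro order.trans[OF area_density_siegel_metric siegel_metric_le])
      (auto simp: siegel_fundamental_domain_def)
  also have "\<dots> \<le> reduction_const' CARD('g) ^ 4 * (real CARD('g))\<^sup>2 *
    (\<Sum>(j, k)\<in>UNIV. strip_weight (\<gamma> t $ Upair j k) * (cmod (deriv (\<lambda>s. \<gamma> s $ Upair j k) t))\<^sup>2)"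
  proof (intro mult_left_mono sum_mono, clarify)
    fix j k
    show "(cmod (?u $ Upair j k))\<^sup>2 / (?Y $ j $ j * ?Y $ k $ k)
      \<le> strip_weight (\<gamma> t $ Upair j k) * (cmod (deriv (\<lambda>s. \<gamma> s $ Upair j k) t))\<^sup>2"
      using mult_right_mono[OF siegel_domain_weight[OF z, of j k], of "(cmod (?u $ Upair j k))\<^sup>2"]
      by (simp add: chart_deriv_def)
  qed auto
  finally show ?thesis .
qed

section \<open>The volume of a curve\<close>

text \<open>The strip is cut into unit squares by the integer part of \<open>|Im w|\<close>, which
  compares the integral with the sum of the inverse squares.\<close>

lemma nn_integral_strip_weight: "(\<integral>\<^sup>+w. ennreal (strip_weight w) \<partial>lborel) < \<infinity>"
proof -
  let ?R = "\<lambda>n::nat. cbox (Complex (- 1 / 2) (real n)) (Complex (1 / 2) (real n + 1)) \<union>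
                   cbox (Complex (- 1 / 2) (- (real n + 1))) (Complex (1 / 2) (- real n))"
  \<comment> \<open>For \<open>n \<ge> 1\<close> one has
    \<open>|Im w| \<ge> n \<ge> (n + 1) / 2\<close>, whence the 4; for \<open>n = 0\<close> the
    floor 3/4 of the weight's denominator exceeds 1/4.\<close>
  let ?c = "\<lambda>n::nat. 4 / (real n + 1)\<^sup>2"
  have term_le: "F n \<le> (\<Sum>n. F n)" for F :: "nat \<Rightarrow> ennreal" and n
    using sum_le_suminf[of F "{n}"] by simp
  have le: "ennreal (strip_weight w) \<le> (\<Sum>n. ennreal (?c n) * indicator (?R n) w)" for w
  proof (cases "\<bar>Re w\<bar> \<le> 1 / 2")
    case True
    define n where "n = nat \<lfloor>\<bar>Im w\<bar>\<rfloor>"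
    have n: "real n \<le> \<bar>Im w\<bar>" "\<bar>Im w\<bar> \<le> real n + 1"
      unfolding n_def by linarith+
    have R: "w \<in> ?R n"
      using True n by (auto simp: in_cbox_complex_iff abs_if split: if_splits)
    have "(real n + 1)\<^sup>2 / 4 \<le> max (3 / 4) ((Im w)\<^sup>2)"
    proof (cases "n = 0")
      case False
      then have "(real n + 1) / 2 \<le> \<bar>Im w\<bar>"
        using n(1) by simp
      then have "((real n + 1) / 2)\<^sup>2 \<le> \<bar>Im w\<bar>\<^sup>2"
        by (intro power_mono) auto
      then show ?thesis by (simp add: power_divide)
    qed simp
    then have "1 / max (3 / 4) ((Im w)\<^sup>2) \<le> 1 / ((real n + 1)\<^sup>2 / 4)"
      by (intro divide_left_mono mult_pos_pos) (auto simp: less_max_iff_disj)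
    then have "strip_weight w \<le> ?c n"
      using True by (simp add: strip_weight_def)
    then have "ennreal (strip_weight w) \<le> ennreal (?c n) * indicator (?R n) w"
      using R by (simp add: ennreal_leI)
    also have "\<dots> \<le> (\<Sum>n. ennreal (?c n) * indicator (?R n) w)"
      by (rule term_le)
    finally show ?thesis .
  qed (simp add: strip_weight_def)
  have meas: "emeasure lborel (?R n) \<le> 2" for n
  proof -
    have "emeasure lborel (?R n) \<le> emeasure lborel (cbox (Complex (- 1 / 2) (real n)) (Complex (1 / 2) (real n + 1)))
        + emeasure lborel (cbox (Complex (- 1 / 2) (- (real n + 1))) (Complex (1 / 2) (- real n)))"
      by (intro emeasure_subadditive) auto
    also have "\<dots> = 1 + 1"
      by (intro arg_cong2[where f = "(+)"]) (subst emeasure_lborel_cbox; auto simp: Basis_complex_def)+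
    finally show ?thesis by simp
  qed
  have "(\<integral>\<^sup>+w. ennreal (strip_weight w) \<partial>lborel) \<le> (\<integral>\<^sup>+w. (\<Sum>n. ennreal (?c n) * indicator (?R n) w) \<partial>lborel)"
    by (intro nn_integral_mono le)
  also have "\<dots> = (\<Sum>n. ennreal (?c n) * emeasure lborel (?R n))"
    by (subst nn_integral_suminf) (auto intro!: suminf_cong nn_integral_cmult_indicator)
  also have "\<dots> \<le> (\<Sum>n. ennreal (8 * inverse (real (Suc n) ^ 2)))"
  proof (intro suminf_le summableI)
    fix n
    have "ennreal (?c n) * emeasure lborel (?R n) \<le> ennreal (?c n) * ennreal 2"
      using meas[of n] by (intro mult_left_mono) auto
    also have "\<dots> = ennreal (8 * inverse (real (Suc n) ^ 2))"
      by (subst ennreal_mult[symmetric]) (auto simp: field_simps)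
    finally show "ennreal (?c n) * emeasure lborel (?R n) \<le> ennreal (8 * inverse (real (Suc n) ^ 2))" .
  qed
  also have "\<dots> < \<infinity>"
  proof -
    have "summable (\<lambda>n. 8 * inverse (real (Suc n) ^ 2))"
      by (intro summable_mult summable_Suc_iff[THEN iffD2] inverse_power_summable) simp
    then show ?thesis
      by (subst suminf_ennreal2) auto
  qed
  finally show ?thesis .
qed

lemma borel_measurable_strip_weight [measurable]: "strip_weight \<in> borel_measurable borel"
  unfolding strip_weight_def by measurable

text \<open>Away from critical points \<open>f\<close> is injective on small discs, and Lindelof's
  theorem selects countably many of them.\<close>

lemma locally_injective_cover:
  assumes D: "open D" and f: "f holomorphic_on D"
  obtains U :: "nat \<Rightarrow> complex set" where "\<And>n. open (U n)" "\<And>n. U n \<subseteq> D" "\<And>n. inj_on f (U n)"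
    "(\<Union>n. U n) = {t \<in> D. deriv f t \<noteq> 0}"
proof -
  let ?D = "{t \<in> D. deriv f t \<noteq> 0}"
  let ?F = "{U. open U \<and> U \<subseteq> ?D \<and> inj_on f U}"
  have "continuous_on D (deriv f)"
    using f D holomorphic_deriv holomorphic_on_imp_continuous_on by blast
  then have "open (D \<inter> deriv f -` (- {0}))"
    using D by (intro continuous_open_preimage) auto
  also have "D \<inter> deriv f -` (- {0}) = ?D" by auto
  finally have oD: "open ?D" .
  have "\<Union>?F = ?D"
  proof (intro equalityI subsetI)
    fix t assume t: "t \<in> ?D"
    then obtain r where r: "r > 0" "ball t r \<subseteq> ?D" "inj_on f (ball t r)"
      using has_complex_derivative_locally_injective[of f ?D t] f oD holomorphic_on_subset[OF f, of ?D] by blast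
    then show "t \<in> \<Union>?F"
      by (intro UnionI[of "ball t r"]) auto
  qed auto
  obtain F where F: "F \<subseteq> ?F" "countable F" "\<Union>F = \<Union>?F"
    using Lindelof[of ?F] by blast
  \<comment> \<open>The empty set is added so that the enumeration makes sense even when
    \<open>F\<close> is empty, as for constant \<open>f\<close>.\<close>
  have U: "from_nat_into (insert {} F) n \<in> insert {} F" for n
    by (intro from_nat_into) simp
  show thesis
  proof (rule that[of "from_nat_into (insert {} F)"])
    fix n
    show "open (from_nat_into (insert {} F) n)" "from_nat_into (insert {} F) n \<subseteq> D"
      "inj_on f (from_nat_into (insert {} F) n)"
      using U[of n] F(1) by auto
  next
    have "range (from_nat_into (insert {} F)) = insert {} F"
      using F(2) by (intro range_from_nat_into) auto
    then show "(\<Union>n. from_nat_into (insert {} F) n) = ?D"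
      using F(3) \<open>\<Union>?F = ?D\<close> by simp
  qed
qed

text \<open>Making the cover disjoint splits \<open>B\<close> up to critical points, where the
  integrand vanishes. The change of variables then applies on each piece.\<close>

lemma holomorphic_image_decomposition:
  assumes D: "open D" and f: "f holomorphic_on D" and B: "B \<in> sets borel" "B \<subseteq> D"
  obtains A :: "nat \<Rightarrow> complex set" where "disjoint_family A" "\<And>n. A n \<subseteq> {t \<in> B. deriv f t \<noteq> 0}"
    "\<And>n. inj_on f (A n)" "\<And>n. f ` A n \<in> sets borel"
    "\<And>h :: complex \<Rightarrow> ennreal. h \<in> borel_measurable borel \<Longrightarrow>
      (\<integral>\<^sup>+t\<in>B. h (f t) * ennreal ((cmod (deriv f t))\<^sup>2) \<partial>lborel) \<le> (\<Sum>n. \<integral>\<^sup>+w\<in>f ` A n. h w \<partial>lborel)"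
proof -
  obtain U :: "nat \<Rightarrow> complex set" where U: "\<And>n. open (U n)" "\<And>n. U n \<subseteq> D" "\<And>n. inj_on f (U n)"
      "(\<Union>n. U n) = {t \<in> D. deriv f t \<noteq> 0}"
    using locally_injective_cover[OF D f] by blast
  define A where "A n = B \<inter> disjointed U n" for n
  have dU: "disjointed U n \<subseteq> U n" "disjointed U n \<in> sets borel" for n
    using U(1) by (auto simp: disjointed_subset disjointed_def)
  have AU: "A n \<subseteq> U n" and Ab: "A n \<in> sets borel" for n
    using dU[of n] B(1) by (auto simp: A_def)
  have disj: "disjoint_family A"
    using disjoint_family_disjointed[of U] by (auto simp: disjoint_family_on_def A_def)
  have Un: "(\<Union>n. A n) = {t \<in> B. deriv f t \<noteq> 0}"
    using UN_disjointed_eq[of U] U(4) B(2) by (auto simp: A_def)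
  have holU: "f holomorphic_on U n" for n
    using f U(2) holomorphic_on_subset by blast
  show thesis
  proof (rule that[of A])
    show "A n \<subseteq> {t \<in> B. deriv f t \<noteq> 0}" for n
      using Un by blast
    show "inj_on f (A n)" for n
      using U(3) AU inj_on_subset by blast
    show "f ` A n \<in> sets borel" for n
      by (rule holomorphic_area_le(1)[OF U(1) holU U(3) Ab AU])
    fix h :: "complex \<Rightarrow> ennreal" assume [measurable]: "h \<in> borel_measurable borel"
    let ?j = "\<lambda>t. h (f t) * ennreal ((cmod (deriv f t))\<^sup>2)"
    have meas: "(\<lambda>t. ?j t * indicator (A n) t) \<in> borel_measurable borel" for n
      by (rule borel_measurable_change_of_variables[OF U(1) holU Ab AU]) measurable
    have "(\<integral>\<^sup>+t\<in>B. ?j t \<partial>lborel) = (\<integral>\<^sup>+t\<in>(\<Union>n. A n). ?j t \<partial>lborel)"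
      unfolding Un by (intro nn_integral_cong) (auto simp: indicator_def)
    also have "\<dots> = (\<integral>\<^sup>+t. (\<Sum>n. ?j t * indicator (A n) t) \<partial>lborel)"
      by (intro nn_integral_cong) (simp only: ennreal_suminf_cmult suminf_indicator[OF disj])
    also have "\<dots> = (\<Sum>n. \<integral>\<^sup>+t\<in>A n. ?j t \<partial>lborel)"
      using meas by (intro nn_integral_suminf) auto
    also have "\<dots> \<le> (\<Sum>n. \<integral>\<^sup>+w\<in>f ` A n. h w \<partial>lborel)"
      by (intro suminf_le summableI holomorphic_change_of_variables_le[OF U(1) holU U(3) Ab AU]) measurable
    finally show "(\<integral>\<^sup>+t\<in>B. ?j t \<partial>lborel) \<le> (\<Sum>n. \<integral>\<^sup>+w\<in>f ` A n. h w \<partial>lborel)" .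
  qed (rule disj)
qed

lemma disjoint_chart_piecesE:
  assumes "disjoint_chart_pieces C P" "x \<in> P"
  obtains D where "curve_chart C D (fst x)" "snd x \<subseteq> D" "snd x \<in> sets borel"
  using assms unfolding disjoint_chart_pieces_def case_prod_beta by blast

text \<open>The preimages of \<open>w\<close> in the injective pieces of all charts are distinct
  transversal points, so the indicators of the images add up to at most \<open>k\<close> at every
  \<open>w\<close>. Integrating \<open>h\<close> against this count gives the bound.\<close>

lemma sum_pieces_coordinate_le:
  assumes deg: "curve_has_degree V k" and CV: "C \<subseteq> V" and P: "disjoint_chart_pieces C P"
    and h[measurable]: "h \<in> borel_measurable borel"
  shows "(\<Sum>(\<gamma>, B)\<in>P. \<integral>\<^sup>+t\<in>B. h (\<gamma> t $ p) * ennreal ((cmod (deriv (\<lambda>s. \<gamma> s $ p) t))\<^sup>2) \<partial>lborel)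
    \<le> of_nat k * (\<integral>\<^sup>+w. h w \<partial>lborel)"
proof -
  let ?f = "\<lambda>x s. fst x s $ p"
  have fin: "finite P" and disjP: "disjoint_family_on (\<lambda>(\<gamma>, B). \<gamma> ` B) P"
    using P by (auto simp: disjoint_chart_pieces_def)
  have "\<forall>x\<in>P. \<exists>D. curve_chart C D (fst x) \<and> snd x \<subseteq> D \<and> snd x \<in> sets borel"
    using disjoint_chart_piecesE[OF P] by metis
  then obtain D where D: "\<And>x. x \<in> P \<Longrightarrow> curve_chart C (D x) (fst x)" "\<And>x. x \<in> P \<Longrightarrow> snd x \<subseteq> D x"
      "\<And>x. x \<in> P \<Longrightarrow> snd x \<in> sets borel"
    by metis
  have oD: "open (D x)" and hol: "(\<lambda>s. fst x s $ i) holomorphic_on D x"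
    and inj: "inj_on (fst x) (D x)" and img: "fst x ` D x \<subseteq> V" if "x \<in> P" for x i
    using D(1)[OF that] CV by (auto simp: curve_chart_def homeomorphism_def dest!: openin_imp_subset intro: inj_on_inverseI)
  define Q where "Q x A \<longleftrightarrow> disjoint_family A \<and> (\<forall>n. A n \<subseteq> {t \<in> snd x. deriv (?f x) t \<noteq> 0}) \<and>
      (\<forall>n. inj_on (?f x) (A n)) \<and> (\<forall>n. ?f x ` A n \<in> sets borel) \<and>
      (\<integral>\<^sup>+t\<in>snd x. h (?f x t) * ennreal ((cmod (deriv (?f x) t))\<^sup>2) \<partial>lborel) \<le> (\<Sum>n. \<integral>\<^sup>+w\<in>?f x ` A n. h w \<partial>lborel)"
    for x and A :: "nat \<Rightarrow> complex set"
  have "\<exists>A. Q x A" if "x \<in> P" for x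
  proof (rule holomorphic_image_decomposition[OF oD[OF that] hol[OF that] D(3)[OF that] D(2)[OF that], of p], goal_cases)
    case (1 A)
    then show ?case
      unfolding Q_def by (intro exI[of _ A] conjI allI 1(5)[OF h]) auto
  qed
  then obtain A where Q: "\<And>x. x \<in> P \<Longrightarrow> Q x (A x)"
    by metis
  have A: "disjoint_family (A x)" "A x n \<subseteq> {t \<in> snd x. deriv (?f x) t \<noteq> 0}"
      "inj_on (?f x) (A x n)" "?f x ` A x n \<in> sets borel"
      "(\<integral>\<^sup>+t\<in>snd x. h (?f x t) * ennreal ((cmod (deriv (?f x) t))\<^sup>2) \<partial>lborel) \<le> (\<Sum>n. \<integral>\<^sup>+w\<in>?f x ` A x n. h w \<partial>lborel)"
    if "x \<in> P" for x n
    using Q[OF that] unfolding Q_def by blast+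
  \<comment> \<open>Truncation at \<open>N\<close> leaves finitely many points, as the counting
    lemma requires; the bound does not depend on \<open>N\<close>, so it passes to the
    supremum.\<close>
  have count: "(\<Sum>x\<in>P. \<Sum>n<N. indicator (?f x ` A x n) w) \<le> (of_nat k :: ennreal)" for w N
  proof -
    define I where "I = {(x, n) \<in> P \<times> {..<N}. w \<in> ?f x ` A x n}"
    have finI: "finite I"
      unfolding I_def by (rule finite_subset[of _ "P \<times> {..<N}"]) (use fin in auto)
    have "\<forall>y\<in>I. \<exists>t. t \<in> A (fst y) (snd y) \<and> ?f (fst y) t = w"
      by (auto simp: I_def)
    then obtain \<tau> where \<tau>: "\<And>x n. (x, n) \<in> I \<Longrightarrow> \<tau> (x, n) \<in> A x n" "\<And>x n. (x, n) \<in> I \<Longrightarrow> ?f x (\<tau> (x, n)) = w"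
      by (metis fst_conv snd_conv)
    have IP: "(x, n) \<in> I \<Longrightarrow> x \<in> P" for x n by (simp add: I_def)
    have \<tau>B: "\<tau> (x, n) \<in> snd x" "\<tau> (x, n) \<in> D x" "deriv (?f x) (\<tau> (x, n)) \<noteq> 0" if "(x, n) \<in> I" for x n
      using \<tau>(1)[OF that] A(2)[OF IP[OF that]] D(2)[OF IP[OF that]] by auto
    define q where "q y = fst (fst y) (\<tau> y)" for y
    \<comment> \<open>Equal points force equal charts because the chart pieces are disjoint, then
      equal parameters because a chart is injective, then equal \<open>n\<close> because the
      \<open>A x n\<close> are disjoint.\<close>
    have "inj_on q I"
    proof (rule inj_onI)
      fix y y' assume y: "y \<in> I" "y' \<in> I" "q y = q y'"
      obtain x n x' n' where yy: "y = (x, n)" "y' = (x', n')" by (metis surj_pair)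
      have "q y \<in> fst x ` snd x" "q y' \<in> fst x' ` snd x'"
        unfolding q_def yy fst_conv using y(1,2) unfolding yy by (auto intro!: imageI \<tau>B(1) simp del: split_paired_All)
      then have "x = x'"
        using disjP y IP yy unfolding disjoint_family_on_def
        by (metis (no_types, lifting) disjoint_iff case_prod_beta)
      then have "\<tau> y = \<tau> y'"
        using inj_onD[OF inj[of x], of "\<tau> y" "\<tau> y'"] y \<tau>B(2) IP yy by (simp add: q_def)
      then have "n = n'"
        using A(1)[of x] \<tau>(1) y IP yy \<open>x = x'\<close> unfolding disjoint_family_on_def
        by (metis (no_types, lifting) disjoint_iff UNIV_I)
      then show "y = y'" using yy \<open>x = x'\<close> by simp
    qed
    then have "card I = card (q ` I)" by (simp add: card_image)
    also have "\<dots> \<le> k"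
    proof (rule card_transversal_points_le[OF deg])
      fix z assume "z \<in> q ` I"
      then obtain x n where y: "(x, n) \<in> I" "z = fst x (\<tau> (x, n))" by (auto simp: q_def)
      show "z $ p = w" using \<tau>(2) y by simp
      show "transversal_point V p z"
        unfolding transversal_point_def
        using IP[OF y(1)] \<tau>B(2,3)[OF y(1)] y(2)
        by (intro exI[of _ "D x"] exI[of _ "fst x"] exI[of _ "\<tau> (x, n)"] conjI allI oD hol img) auto
    qed (use finI in simp)
    finally have "card I \<le> k" .
    moreover have "(\<Sum>x\<in>P. \<Sum>n<N. indicator (?f x ` A x n) w) = (of_nat (card I) :: ennreal)"
    proof -
      have "(\<Sum>x\<in>P. \<Sum>n<N. indicator (?f x ` A x n) w) = (\<Sum>(x, n)\<in>P \<times> {..<N}. indicator (?f x ` A x n) w :: ennreal)"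
        by (rule sum.cartesian_product)
      also have "\<dots> = (\<Sum>(x, n)\<in>I. 1)"
        unfolding I_def by (rule sum.mono_neutral_cong_right) (use fin in \<open>auto simp: indicator_def\<close>)
      finally show ?thesis by (simp add: case_prod_unfold)
    qed
    ultimately show ?thesis by simp
  qed
  have "(\<Sum>(\<gamma>, B)\<in>P. \<integral>\<^sup>+t\<in>B. h (\<gamma> t $ p) * ennreal ((cmod (deriv (\<lambda>s. \<gamma> s $ p) t))\<^sup>2) \<partial>lborel)
      \<le> (\<Sum>x\<in>P. \<Sum>n. \<integral>\<^sup>+w\<in>?f x ` A x n. h w \<partial>lborel)"
    using A(5) by (intro sum_mono) (simp add: case_prod_unfold)
  also have "\<dots> = (\<Sum>n. \<Sum>x\<in>P. \<integral>\<^sup>+w\<in>?f x ` A x n. h w \<partial>lborel)"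
    by (intro suminf_sum[symmetric] summableI)
  also have "\<dots> = (SUP N. \<Sum>n<N. \<Sum>x\<in>P. \<integral>\<^sup>+w\<in>?f x ` A x n. h w \<partial>lborel)"
    by (rule suminf_eq_SUP)
  also have "\<dots> \<le> of_nat k * (\<integral>\<^sup>+w. h w \<partial>lborel)"
  proof (rule SUP_least)
    fix N
    have m: "(\<lambda>w. h w * indicator (?f x ` A x n) w) \<in> borel_measurable lborel" if "x \<in> P" for x n
      using A(4)[OF that, of n] by measurable
    have "(\<Sum>n<N. \<Sum>x\<in>P. \<integral>\<^sup>+w\<in>?f x ` A x n. h w \<partial>lborel) = (\<Sum>x\<in>P. \<Sum>n<N. \<integral>\<^sup>+w\<in>?f x ` A x n. h w \<partial>lborel)"
      by (rule sum.swap)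
    also have "\<dots> = (\<Sum>x\<in>P. \<integral>\<^sup>+w. (\<Sum>n<N. h w * indicator (?f x ` A x n) w) \<partial>lborel)"
      using m by (intro sum.cong refl nn_integral_sum[symmetric])
    also have "\<dots> = (\<integral>\<^sup>+w. (\<Sum>x\<in>P. \<Sum>n<N. h w * indicator (?f x ` A x n) w) \<partial>lborel)"
      using m by (intro nn_integral_sum[symmetric] borel_measurable_sum)
    also have "\<dots> = (\<integral>\<^sup>+w. h w * (\<Sum>x\<in>P. \<Sum>n<N. indicator (?f x ` A x n) w) \<partial>lborel)"
      by (simp only: sum_distrib_left)
    also have "\<dots> \<le> (\<integral>\<^sup>+w. h w * of_nat k \<partial>lborel)"
      by (intro nn_integral_mono mult_left_mono count) simp
    also have "\<dots> = of_nat k * (\<integral>\<^sup>+w. h w \<partial>lborel)"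
      by (simp add: nn_integral_multc) (simp add: mult.commute)
    finally show "(\<Sum>n<N. \<Sum>x\<in>P. \<integral>\<^sup>+w\<in>?f x ` A x n. h w \<partial>lborel) \<le> of_nat k * (\<integral>\<^sup>+w. h w \<partial>lborel)" .
  qed
  finally show ?thesis .
qed

theorem theorem4p1:
  shows "\<exists>c::real. c > 0 \<and>
    (\<forall>(C :: (complex ^ ('g::{finite, linorder} uprod)) set) k.
       siegel_curve C \<and> curve_has_degree (zariski_closure C) k \<longrightarrow>
       curve_volume siegel_metric C (C \<inter> siegel_fundamental_domain) \<le> ennreal (c * real k))"
proof -
  let ?h = "\<lambda>w. ennreal (strip_weight w)"
  define W where "W = enn2real (\<integral>\<^sup>+w. ?h w \<partial>lborel)"
  have W: "(\<integral>\<^sup>+w. ?h w \<partial>lborel) = ennreal W" "0 \<le> W"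
    using nn_integral_strip_weight by (auto simp: W_def)
  define K where "K = reduction_const' CARD('g) ^ 4 * (real CARD('g))\<^sup>2"
  have K: "0 \<le> K" by (simp add: K_def)
  let ?I = "UNIV :: ('g \<times> 'g) set"
  \<comment> \<open>The estimate runs over ordered pairs \<open>(j, k)\<close>; adding 1 makes
    \<open>c\<close> positive without a lower bound for \<open>W\<close>.\<close>
  define c where "c = K * (real (card ?I) * W) + 1"
  have "curve_volume siegel_metric C (C \<inter> siegel_fundamental_domain) \<le> ennreal (c * real k)"
    if deg: "curve_has_degree (zariski_closure C) k" for C :: "(complex ^ ('g uprod)) set" and k
    unfolding curve_volume_def
  proof (rule SUP_least)
    let ?S = "C \<inter> siegel_fundamental_domain"
    fix P assume "P \<in> Collect (disjoint_chart_pieces C)"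
    then have P: "disjoint_chart_pieces C P" by simp
    have CV: "C \<subseteq> zariski_closure C"
      by (auto simp: zariski_closure_def)
    let ?j = "\<lambda>p \<gamma> t. ?h (\<gamma> t $ p) * ennreal ((cmod (deriv (\<lambda>s. \<gamma> s $ p) t))\<^sup>2)"
    have piece: "(\<integral>\<^sup>+t\<in>{t \<in> B. \<gamma> t \<in> ?S}. ennreal (area_density siegel_metric \<gamma> t) \<partial>lborel)
        \<le> ennreal K * (\<Sum>(j, k)\<in>?I. \<integral>\<^sup>+t\<in>B. ?j (Upair j k) \<gamma> t \<partial>lborel)" if x: "(\<gamma>, B) \<in> P" for \<gamma> B
    proof -
      obtain D where D: "curve_chart C D \<gamma>" "B \<subseteq> D" "B \<in> sets borel"
        using disjoint_chart_piecesE[OF P x] by auto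
      then have hol: "(\<lambda>s. \<gamma> s $ p) holomorphic_on D" and oD: "open D" for p
        by (auto simp: curve_chart_def)
      have meas: "(\<lambda>t. ?j p \<gamma> t * indicator B t) \<in> borel_measurable lborel" for p
        using borel_measurable_change_of_variables[OF oD hol D(3,2), of ?h p] by simp
      \<comment> \<open>The majorant is nonnegative, so it may be integrated over all of
        \<open>B\<close>, where it is Borel; \<open>strip_weight\<close> still cuts each coordinate
        down to the strip.\<close>
      have "(\<integral>\<^sup>+t\<in>{t \<in> B. \<gamma> t \<in> ?S}. ennreal (area_density siegel_metric \<gamma> t) \<partial>lborel)
          \<le> (\<integral>\<^sup>+t. ennreal K * (\<Sum>(j, k)\<in>?I. ?j (Upair j k) \<gamma> t * indicator B t) \<partial>lborel)"
      proof (rule nn_integral_mono)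
        fix t
        show "ennreal (area_density siegel_metric \<gamma> t) * indicator {t \<in> B. \<gamma> t \<in> ?S} t
            \<le> ennreal K * (\<Sum>(j, k)\<in>?I. ?j (Upair j k) \<gamma> t * indicator B t)"
        proof (cases "t \<in> B \<and> \<gamma> t \<in> ?S")
          case True
          have nn: "0 \<le> strip_weight w" for w by (simp add: strip_weight_def le_max_iff_disj)
          have "ennreal (area_density siegel_metric \<gamma> t) \<le> ennreal (K *
             (\<Sum>(j, k)\<in>?I. strip_weight (\<gamma> t $ Upair j k) * (cmod (deriv (\<lambda>s. \<gamma> s $ Upair j k) t))\<^sup>2))"
            unfolding K_def using True by (intro ennreal_leI area_density_le) auto
          also have "\<dots> = ennreal K * (\<Sum>(j, k)\<in>?I. ?j (Upair j k) \<gamma> t)"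
            using K nn by (simp add: ennreal_mult sum_nonneg case_prod_unfold flip: sum_ennreal)
          finally show ?thesis using True by simp
        qed simp
      qed
      also have "\<dots> = ennreal K * (\<Sum>(j, k)\<in>?I. \<integral>\<^sup>+t\<in>B. ?j (Upair j k) \<gamma> t \<partial>lborel)"
        unfolding case_prod_unfold
        by (subst nn_integral_cmult, intro borel_measurable_sum meas, subst nn_integral_sum, rule meas, rule refl)
      finally show ?thesis .
    qed
    have "(\<Sum>(\<gamma>, B)\<in>P. \<integral>\<^sup>+t\<in>{t \<in> B. \<gamma> t \<in> ?S}. ennreal (area_density siegel_metric \<gamma> t) \<partial>lborel)
        \<le> (\<Sum>(\<gamma>, B)\<in>P. ennreal K * (\<Sum>(j, k)\<in>?I. \<integral>\<^sup>+t\<in>B. ?j (Upair j k) \<gamma> t \<partial>lborel))"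
      using piece by (intro sum_mono) auto
    also have "\<dots> = ennreal K * (\<Sum>(j, k)\<in>?I. \<Sum>(\<gamma>, B)\<in>P. \<integral>\<^sup>+t\<in>B. ?j (Upair j k) \<gamma> t \<partial>lborel)"
      unfolding case_prod_unfold by (subst sum.swap) (simp only: sum_distrib_left)
    \<comment> \<open>With the coordinate fixed, all pieces are bounded together, so the result does
      not depend on their number and survives the supremum over \<open>P\<close>.\<close>
    also have "\<dots> \<le> ennreal K * (\<Sum>(j, k')\<in>?I. of_nat k * ennreal W)"
      using sum_pieces_coordinate_le[OF deg CV P, of ?h]
      by (intro mult_left_mono sum_mono) (auto simp: W)
    also have "\<dots> = ennreal (K * (real (card ?I) * W) * real k)"
      using K W(2) by (simp add: ennreal_mult case_prod_unfold mult_ac flip: ennreal_of_nat_eq_real_of_nat)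
    also have "\<dots> \<le> ennreal (c * real k)"
      by (intro ennreal_leI mult_right_mono) (auto simp: c_def)
    finally show "(\<Sum>(\<gamma>, B)\<in>P. \<integral>\<^sup>+t\<in>{t \<in> B. \<gamma> t \<in> ?S}. ennreal (area_density siegel_metric \<gamma> t) \<partial>lborel)
        \<le> ennreal (c * real k)" .
  qed
  moreover have "c > 0"
    using K W(2) by (simp add: c_def add_nonneg_pos)
  ultimately show ?thesis by blast
qed

end
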